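(* Let $\mathcal T$ be a strict tensor $W^*$-category equipped with a faithful idempotent tensor $^*$-functor $\iota$ into a tensor subcategory of Hilbert spaces (in the precise sense of the context), and suppose that $\mathcal T$ has a regular object $(\xi,V,\eta)$. Then $\mathcal T$ is isomorphic to a tensor subcategory of $\mathcal R(\iota(\eta_V))$ and also to a tensor subcategory of $\mathcal C(\iota(\xi_V)^{-1})$. Moreover there is an associated standard braided symmetry $\varepsilon$ given by $$\varepsilon_W=\xi_W^{-1}\circ\theta_W\circ\eta_W$$ for every object $W$ of $\mathcal T$.
   Context: Notation: $(X,Y)$ denotes arrows, $\circ$ composition, $\times$ the tensor product on objects and arrows (evaluated before $\circ$), $1_X$ identities, $\mathbb C$ the tensor unit. The tensor product of Hilbert spaces $H,K$ is written $HK$; $\vartheta$ is the flip. Setting: $\iota:\mathcal T\to\mathcal T$ is a faithful tensor $^*$-functor with $\iota^2=\iota$, and $\iota(\mathcal T)$ is a tensor $W^*$-category of Hilbert spaces: $(\mathbb C,\mathbb C)$ is the complex numbers and every object is a (possibly infinite) direct sum of $\mathbb C$. $\iota(\mathcal T)$ has its permutation symmetry $\vartheta$, and for all objects $W,W'$ there are (necessarily unique) arrows $\vartheta_{W,\iota(W')}\in(W\times\iota(W'),\iota(W')\times W)$ and $\vartheta_{\iota(W),W'}\in(\iota(W)\times W',W'\times\iota(W))$ with image $\vartheta_{\iota(W),\iota(W')}$ under $\iota$. Fix an object $V$; $L$ and $R$ are the functors of tensoring on the left, resp. right, by $V$. - $(V,\eta)$ is right regular if $\eta\in(R,R\iota)$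 is a unitary natural transformation with $\eta_{W\times W'}=(\eta_W)_{13}\circ 1_W\times\eta_{W'}$, where $(\eta_W)_{13}:=1_{\iota(W)}\times\vartheta_{V,\iota(W')}\circ\eta_W\times 1_{\iota(W')}\circ 1_W\times\vartheta_{\iota(W'),V}$. - $(\xi,V)$ is left regular if $\xi\in(L,L\iota)$ is a unitary natural transformation with $\xi_{W\times W'}=(\xi_{W'})_{13}\circ\xi_W\times 1_{W'}$, where $(\xi_{W'})_{13}:=\vartheta_{\iota(W),V}\times 1_{\iota(W')}\circ 1_{\iota(W)}\times\xi_{W'}\circ\vartheta_{V,\iota(W)}\times 1_{W'}$. - $\theta\in(R\iota,L\iota)$ is $\theta_W:=\vartheta_{\iota(W),V}$. - A braided symmetry relative to $V$ is a unitary natural transformation $\varepsilon\in(R,L)$ with $\varepsilon_{W\times W'}=\varepsilon_W\times 1_{W'}\circ 1_W\times\varepsilon_{W'}$. - $(\xi,V,\eta)$ is a regular object if $(\xi,V)$ is left regular, $(V,\eta)$ is right regular, and $\eta_W\times 1_{\iota(W')}\circ 1_W\times\xi_{W'}=1_{\iota(W)}\times\xi_{W'}\circ\eta_W\times 1_{W'}$ for all objects $W,W'$. - A braided symmetry $\varepsilon$ is standard if $\xi_W\circ\varepsilon_W=\theta_W\circ\eta_W$ for all $W$ with $(\xi,V,\eta)$ a regular object. Multiplicative unitary on $K$: a unitary $V\in(K^2,K^2)$ with $V_{12}V_{13}V_{23}=V_{23}V_{12}$. $\mathcal R(V)$: objects are representations, i.e. unitaries $W\in(HK,HK)$ with $W_{12}W_{13}V_{23}=V_{23}W_{12}$;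 arrows $T\in(H,H')$ with $(T\times 1_K)W=W'(T\times 1_K)$; tensor product $W\times W'=W_{13}W'_{23}$. $\mathcal C(V)$: objects are corepresentations, i.e. unitaries $W\in(KH,KH)$ with $V_{12}W_{13}W_{23}=W_{23}V_{12}$; arrows $T$ with $(1_K\times T)W=W'(1_K\times T)$; tensor product $W\times W'=W_{12}W'_{13}$. The corollary includes the assertion that $\iota(\eta_V)$ and $\iota(\xi_V)^{-1}$ are multiplicative unitaries. *)

theory Defs
  imports "HOL-Analysis.Analysis"
begin

section \<open>Complex normed spaces and preduals\<close>

class complex_normed_vector = real_normed_vector +
  fixes scaleC :: "complex \<Rightarrow> 'a \<Rightarrow> 'a" (infixr "*\<^sub>C" 75)
  assumes scaleC_add_right: "c *\<^sub>C (x + y) = c *\<^sub>C x + c *\<^sub>C y"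
    and scaleC_add_left: "(c + d) *\<^sub>C x = c *\<^sub>C x + d *\<^sub>C x"
    and scaleC_scaleC: "c *\<^sub>C (d *\<^sub>C x) = (c * d) *\<^sub>C x"
    and scaleR_scaleC: "r *\<^sub>R x = complex_of_real r *\<^sub>C x"
    and norm_scaleC: "norm (c *\<^sub>C x) = cmod c * norm x"

definition csubspace :: "'a::complex_normed_vector set \<Rightarrow> bool" where
  "csubspace E \<longleftrightarrow> 0 \<in> E \<and> (\<forall>x\<in>E. \<forall>y\<in>E. x + y \<in> E) \<and> (\<forall>c. \<forall>x\<in>E. c *\<^sub>C x \<in> E)"

text \<open>Functionals on a subspace are represented by functions that vanish off the subspace.\<close>

definition bounded_functional :: "'a::complex_normed_vector set \<Rightarrow> ('a \<Rightarrow> complex) \<Rightarrow> bool" where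
  "bounded_functional E \<phi> \<longleftrightarrow>
     (\<forall>x\<in>E. \<forall>y\<in>E. \<phi> (x + y) = \<phi> x + \<phi> y) \<and> (\<forall>c. \<forall>x\<in>E. \<phi> (c *\<^sub>C x) = c * \<phi> x) \<and>
     (\<exists>B. \<forall>x\<in>E. cmod (\<phi> x) \<le> B * norm x) \<and> (\<forall>x. x \<notin> E \<longrightarrow> \<phi> x = 0)"

definition dual_norm :: "'a::complex_normed_vector set \<Rightarrow> ('a \<Rightarrow> complex) \<Rightarrow> real" where
  "dual_norm E \<phi> = (SUP x\<in>{x \<in> E. norm x \<le> 1}. cmod (\<phi> x))"

text \<open>A predual of \<open>E\<close>, taken inside the Banach dual \<open>E\<^sup>*\<close>: a norm-closed subspace \<open>P\<close> such that
  evaluation is an isometric isomorphism of \<open>E\<close> onto the dual of \<open>P\<close>. A Banach space is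
  isometrically a dual space iff it has such a \<open>P\<close>.\<close>

definition predual :: "'a::complex_normed_vector set \<Rightarrow> ('a \<Rightarrow> complex) set \<Rightarrow> bool" where
  "predual E P \<longleftrightarrow>
     (\<forall>\<phi>\<in>P. bounded_functional E \<phi>) \<and> (\<lambda>x. 0) \<in> P \<and>
     (\<forall>\<phi>\<in>P. \<forall>\<psi>\<in>P. (\<lambda>x. \<phi> x + \<psi> x) \<in> P) \<and> (\<forall>c. \<forall>\<phi>\<in>P. (\<lambda>x. c * \<phi> x) \<in> P) \<and>
     (\<forall>\<phi>. bounded_functional E \<phi> \<and> (\<forall>e>0. \<exists>\<psi>\<in>P. dual_norm E (\<lambda>x. \<phi> x - \<psi> x) < e) \<longrightarrow> \<phi> \<in> P) \<and>
     (\<forall>x\<in>E. norm x = (SUP \<phi>\<in>{\<phi> \<in> P. dual_norm E \<phi> \<le> 1}. cmod (\<phi> x))) \<and>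
     (\<forall>\<Lambda> :: ('a \<Rightarrow> complex) \<Rightarrow> complex.
        (\<forall>\<phi>\<in>P. \<forall>\<psi>\<in>P. \<Lambda> (\<lambda>x. \<phi> x + \<psi> x) = \<Lambda> \<phi> + \<Lambda> \<psi>) \<and>
        (\<forall>c. \<forall>\<phi>\<in>P. \<Lambda> (\<lambda>x. c * \<phi> x) = c * \<Lambda> \<phi>) \<and>
        (\<exists>B. \<forall>\<phi>\<in>P. cmod (\<Lambda> \<phi>) \<le> B * dual_norm E \<phi>)
        \<longrightarrow> (\<exists>x\<in>E. \<forall>\<phi>\<in>P. \<Lambda> \<phi> = \<phi> x))"

text \<open>For the arrow spaces of a \<open>W\<^sup>*\<close>-category the predual is unique, so the following are the
  \<open>\<sigma>\<close>-weakly continuous functionals and the \<open>\<sigma>\<close>-weakly continuous linear maps.\<close>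

definition normal_functional :: "'a::complex_normed_vector set \<Rightarrow> ('a \<Rightarrow> complex) \<Rightarrow> bool" where
  "normal_functional E \<phi> \<longleftrightarrow> (\<exists>P. predual E P \<and> \<phi> \<in> P)"

definition normal_map ::
  "'a::complex_normed_vector set \<Rightarrow> 'b::complex_normed_vector set \<Rightarrow> ('a \<Rightarrow> 'b) \<Rightarrow> bool" where
  "normal_map E E' f \<longleftrightarrow>
     (\<forall>\<psi>. normal_functional E' \<psi> \<longrightarrow> normal_functional E (\<lambda>x. if x \<in> E then \<psi> (f x) else 0))"


section \<open>Strict tensor \<open>W\<^sup>*\<close>-categories\<close>

text \<open>All arrows of a category are elements of one normed space, of which every arrow space
  \<open>Hom X Y\<close> is a closed subspace. This is no restriction: embed the arrow spaces in their
  \<open>\<ell>\<^sup>\<infinity>\<close>-direct sum; then different arrow spaces have only \<open>0\<close> in common, so that the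
  operations on arrows need no reference to source and target.\<close>

record ('o, 'a) tcat =
  Obj :: "'o set"
  Hom :: "'o \<Rightarrow> 'o \<Rightarrow> 'a set"
  Id :: "'o \<Rightarrow> 'a" ("\<one>\<index>")
  Comp :: "'a \<Rightarrow> 'a \<Rightarrow> 'a" (infixr "\<cdot>\<index>" 70)
  Adj :: "'a \<Rightarrow> 'a" ("_\<^sup>\<dagger>\<index>" [1000] 999)
  Unit :: "'o" ("\<U>\<index>")
  TensOb :: "'o \<Rightarrow> 'o \<Rightarrow> 'o" (infixr "\<otimes>\<index>" 75)
  TensAr :: "'a \<Rightarrow> 'a \<Rightarrow> 'a" (infixr "\<boxtimes>\<index>" 75)

locale category =
  fixes T :: "('o, 'a, 'm) tcat_scheme" (structure)
  assumes id_in: "X \<in> Obj T \<Longrightarrow> \<one> X \<in> Hom T X X"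
    and comp_in: "\<lbrakk>X \<in> Obj T; Y \<in> Obj T; Z \<in> Obj T; f \<in> Hom T X Y; g \<in> Hom T Y Z\<rbrakk>
      \<Longrightarrow> g \<cdot> f \<in> Hom T X Z"
    and comp_assoc: "\<lbrakk>X \<in> Obj T; Y \<in> Obj T; Z \<in> Obj T; Z' \<in> Obj T;
        f \<in> Hom T X Y; g \<in> Hom T Y Z; h \<in> Hom T Z Z'\<rbrakk> \<Longrightarrow> (h \<cdot> g) \<cdot> f = h \<cdot> (g \<cdot> f)"
    and id_left: "\<lbrakk>X \<in> Obj T; Y \<in> Obj T; f \<in> Hom T X Y\<rbrakk> \<Longrightarrow> \<one> Y \<cdot> f = f"
    and id_right: "\<lbrakk>X \<in> Obj T; Y \<in> Obj T; f \<in> Hom T X Y\<rbrakk> \<Longrightarrow> f \<cdot> \<one> X = f"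

text \<open>In \<open>adj_comp_pos\<close>, positivity of \<open>f\<^sup>*f\<close> in the \<open>C\<^sup>*\<close>-algebra \<open>(X,X)\<close> is expressed as being
  of the form \<open>h\<^sup>*h\<close> with \<open>h \<in> (X,X)\<close>.\<close>

locale cstar_category = category T
  for T :: "('o, 'a::complex_normed_vector, 'm) tcat_scheme" (structure) +
  assumes hom_subspace: "\<lbrakk>X \<in> Obj T; Y \<in> Obj T\<rbrakk> \<Longrightarrow> csubspace (Hom T X Y)"
    and hom_complete: "\<lbrakk>X \<in> Obj T; Y \<in> Obj T\<rbrakk> \<Longrightarrow> complete (Hom T X Y)"
    and comp_add_left: "\<lbrakk>X \<in> Obj T; Y \<in> Obj T; Z \<in> Obj T; f \<in> Hom T X Y; g \<in> Hom T Y Z; g' \<in> Hom T Y Z\<rbrakk>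
      \<Longrightarrow> (g + g') \<cdot> f = (g \<cdot> f) + (g' \<cdot> f)"
    and comp_add_right: "\<lbrakk>X \<in> Obj T; Y \<in> Obj T; Z \<in> Obj T; f \<in> Hom T X Y; f' \<in> Hom T X Y; g \<in> Hom T Y Z\<rbrakk>
      \<Longrightarrow> g \<cdot> (f + f') = (g \<cdot> f) + (g \<cdot> f')"
    and comp_scale_left: "\<lbrakk>X \<in> Obj T; Y \<in> Obj T; Z \<in> Obj T; f \<in> Hom T X Y; g \<in> Hom T Y Z\<rbrakk>
      \<Longrightarrow> (c *\<^sub>C g) \<cdot> f = c *\<^sub>C (g \<cdot> f)"
    and comp_scale_right: "\<lbrakk>X \<in> Obj T; Y \<in> Obj T; Z \<in> Obj T; f \<in> Hom T X Y; g \<in> Hom T Y Z\<rbrakk>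
      \<Longrightarrow> g \<cdot> (c *\<^sub>C f) = c *\<^sub>C (g \<cdot> f)"
    and adj_in: "\<lbrakk>X \<in> Obj T; Y \<in> Obj T; f \<in> Hom T X Y\<rbrakk> \<Longrightarrow> f\<^sup>\<dagger> \<in> Hom T Y X"
    and adj_adj: "\<lbrakk>X \<in> Obj T; Y \<in> Obj T; f \<in> Hom T X Y\<rbrakk> \<Longrightarrow> (f\<^sup>\<dagger>)\<^sup>\<dagger> = f"
    and adj_comp: "\<lbrakk>X \<in> Obj T; Y \<in> Obj T; Z \<in> Obj T; f \<in> Hom T X Y; g \<in> Hom T Y Z\<rbrakk>
      \<Longrightarrow> (g \<cdot> f)\<^sup>\<dagger> = f\<^sup>\<dagger> \<cdot> g\<^sup>\<dagger>"
    and adj_add: "\<lbrakk>X \<in> Obj T; Y \<in> Obj T; f \<in> Hom T X Y; g \<in> Hom T X Y\<rbrakk>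
      \<Longrightarrow> (f + g)\<^sup>\<dagger> = f\<^sup>\<dagger> + g\<^sup>\<dagger>"
    and adj_scale: "\<lbrakk>X \<in> Obj T; Y \<in> Obj T; f \<in> Hom T X Y\<rbrakk> \<Longrightarrow> (c *\<^sub>C f)\<^sup>\<dagger> = cnj c *\<^sub>C f\<^sup>\<dagger>"
    and norm_comp: "\<lbrakk>X \<in> Obj T; Y \<in> Obj T; Z \<in> Obj T; f \<in> Hom T X Y; g \<in> Hom T Y Z\<rbrakk>
      \<Longrightarrow> norm (g \<cdot> f) \<le> norm g * norm f"
    and cstar_identity: "\<lbrakk>X \<in> Obj T; Y \<in> Obj T; f \<in> Hom T X Y\<rbrakk> \<Longrightarrow> norm (f\<^sup>\<dagger> \<cdot> f) = (norm f)\<^sup>2"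
    and adj_comp_pos: "\<lbrakk>X \<in> Obj T; Y \<in> Obj T; f \<in> Hom T X Y\<rbrakk>
      \<Longrightarrow> \<exists>h\<in>Hom T X X. f\<^sup>\<dagger> \<cdot> f = h\<^sup>\<dagger> \<cdot> h"

locale wstar_category = cstar_category T
  for T :: "('o, 'a::complex_normed_vector, 'm) tcat_scheme" (structure) +
  assumes hom_predual: "\<lbrakk>X \<in> Obj T; Y \<in> Obj T\<rbrakk> \<Longrightarrow> \<exists>P. predual (Hom T X Y) P"

text \<open>As usual for tensor \<open>W\<^sup>*\<close>-categories, the tensor product is separately \<open>\<sigma>\<close>-weakly continuous.\<close>

locale tensor_wstar_category = wstar_category T
  for T :: "('o, 'a::complex_normed_vector, 'm) tcat_scheme" (structure) +
  assumes unit_ob: "\<U> \<in> Obj T"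
    and tens_ob: "\<lbrakk>X \<in> Obj T; Y \<in> Obj T\<rbrakk> \<Longrightarrow> X \<otimes> Y \<in> Obj T"
    and tens_ob_assoc: "\<lbrakk>X \<in> Obj T; Y \<in> Obj T; Z \<in> Obj T\<rbrakk> \<Longrightarrow> (X \<otimes> Y) \<otimes> Z = X \<otimes> (Y \<otimes> Z)"
    and unit_tens_ob: "X \<in> Obj T \<Longrightarrow> \<U> \<otimes> X = X"
    and tens_ob_unit: "X \<in> Obj T \<Longrightarrow> X \<otimes> \<U> = X"
    and tens_in: "\<lbrakk>X \<in> Obj T; Y \<in> Obj T; X' \<in> Obj T; Y' \<in> Obj T; f \<in> Hom T X Y; g \<in> Hom T X' Y'\<rbrakk>
      \<Longrightarrow> f \<boxtimes> g \<in> Hom T (X \<otimes> X') (Y \<otimes> Y')"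
    and tens_assoc: "\<lbrakk>X \<in> Obj T; Y \<in> Obj T; X' \<in> Obj T; Y' \<in> Obj T; X'' \<in> Obj T; Y'' \<in> Obj T;
        f \<in> Hom T X Y; g \<in> Hom T X' Y'; h \<in> Hom T X'' Y''\<rbrakk> \<Longrightarrow> (f \<boxtimes> g) \<boxtimes> h = f \<boxtimes> (g \<boxtimes> h)"
    and unit_tens: "\<lbrakk>X \<in> Obj T; Y \<in> Obj T; f \<in> Hom T X Y\<rbrakk> \<Longrightarrow> \<one> \<U> \<boxtimes> f = f"
    and tens_unit: "\<lbrakk>X \<in> Obj T; Y \<in> Obj T; f \<in> Hom T X Y\<rbrakk> \<Longrightarrow> f \<boxtimes> \<one> \<U> = f"
    and tens_id: "\<lbrakk>X \<in> Obj T; Y \<in> Obj T\<rbrakk> \<Longrightarrow> \<one> X \<boxtimes> \<one> Y = \<one> (X \<otimes> Y)"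
    and tens_comp: "\<lbrakk>X \<in> Obj T; Y \<in> Obj T; Z \<in> Obj T; X' \<in> Obj T; Y' \<in> Obj T; Z' \<in> Obj T;
        f \<in> Hom T X Y; g \<in> Hom T Y Z; f' \<in> Hom T X' Y'; g' \<in> Hom T Y' Z'\<rbrakk>
      \<Longrightarrow> (g \<boxtimes> g') \<cdot> (f \<boxtimes> f') = (g \<cdot> f) \<boxtimes> (g' \<cdot> f')"
    and tens_add_left: "\<lbrakk>X \<in> Obj T; Y \<in> Obj T; X' \<in> Obj T; Y' \<in> Obj T;
        f \<in> Hom T X Y; f' \<in> Hom T X Y; g \<in> Hom T X' Y'\<rbrakk> \<Longrightarrow> (f + f') \<boxtimes> g = (f \<boxtimes> g) + (f' \<boxtimes> g)"
    and tens_add_right: "\<lbrakk>X \<in> Obj T; Y \<in> Obj T; X' \<in> Obj T; Y' \<in> Obj T;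
        f \<in> Hom T X Y; g \<in> Hom T X' Y'; g' \<in> Hom T X' Y'\<rbrakk> \<Longrightarrow> f \<boxtimes> (g + g') = (f \<boxtimes> g) + (f \<boxtimes> g')"
    and tens_scale_left: "\<lbrakk>X \<in> Obj T; Y \<in> Obj T; X' \<in> Obj T; Y' \<in> Obj T;
        f \<in> Hom T X Y; g \<in> Hom T X' Y'\<rbrakk> \<Longrightarrow> (c *\<^sub>C f) \<boxtimes> g = c *\<^sub>C (f \<boxtimes> g)"
    and tens_scale_right: "\<lbrakk>X \<in> Obj T; Y \<in> Obj T; X' \<in> Obj T; Y' \<in> Obj T;
        f \<in> Hom T X Y; g \<in> Hom T X' Y'\<rbrakk> \<Longrightarrow> f \<boxtimes> (c *\<^sub>C g) = c *\<^sub>C (f \<boxtimes> g)"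
    and tens_adj: "\<lbrakk>X \<in> Obj T; Y \<in> Obj T; X' \<in> Obj T; Y' \<in> Obj T;
        f \<in> Hom T X Y; g \<in> Hom T X' Y'\<rbrakk> \<Longrightarrow> (f \<boxtimes> g)\<^sup>\<dagger> = f\<^sup>\<dagger> \<boxtimes> g\<^sup>\<dagger>"
    and tens_normal_left: "\<lbrakk>X \<in> Obj T; Y \<in> Obj T; X' \<in> Obj T; Y' \<in> Obj T; g \<in> Hom T X' Y'\<rbrakk>
      \<Longrightarrow> normal_map (Hom T X Y) (Hom T (X \<otimes> X') (Y \<otimes> Y')) (\<lambda>f. f \<boxtimes> g)"
    and tens_normal_right: "\<lbrakk>X \<in> Obj T; Y \<in> Obj T; X' \<in> Obj T; Y' \<in> Obj T; f \<in> Hom T X Y\<rbrakk>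
      \<Longrightarrow> normal_map (Hom T X' Y') (Hom T (X \<otimes> X') (Y \<otimes> Y')) (\<lambda>g. f \<boxtimes> g)"

text \<open>The inverse of a unitary arrow is its adjoint, and it is written as such below.\<close>

definition unitary :: "('o, 'a, 'm) tcat_scheme \<Rightarrow> 'o \<Rightarrow> 'o \<Rightarrow> 'a \<Rightarrow> bool" where
  "unitary T X Y u \<longleftrightarrow> u \<in> Hom T X Y \<and> u\<^sup>\<dagger>\<^bsub>T\<^esub> \<cdot>\<^bsub>T\<^esub> u = \<one>\<^bsub>T\<^esub> X \<and> u \<cdot>\<^bsub>T\<^esub> u\<^sup>\<dagger>\<^bsub>T\<^esub> = \<one>\<^bsub>T\<^esub> Y"

locale permutation_symmetry =
  fixes T :: "('o, 'a, 'm) tcat_scheme" (structure) and \<sigma> :: "'o \<Rightarrow> 'o \<Rightarrow> 'a"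
  assumes sym_unitary: "\<lbrakk>X \<in> Obj T; Y \<in> Obj T\<rbrakk> \<Longrightarrow> unitary T (X \<otimes> Y) (Y \<otimes> X) (\<sigma> X Y)"
    and sym_natural: "\<lbrakk>X \<in> Obj T; Y \<in> Obj T; X' \<in> Obj T; Y' \<in> Obj T; f \<in> Hom T X X'; g \<in> Hom T Y Y'\<rbrakk>
      \<Longrightarrow> \<sigma> X' Y' \<cdot> (f \<boxtimes> g) = (g \<boxtimes> f) \<cdot> \<sigma> X Y"
    and sym_tens: "\<lbrakk>X \<in> Obj T; Y \<in> Obj T; Z \<in> Obj T\<rbrakk>
      \<Longrightarrow> \<sigma> (X \<otimes> Y) Z = (\<sigma> X Z \<boxtimes> \<one> Y) \<cdot> (\<one> X \<boxtimes> \<sigma> Y Z)"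
    and sym_sym: "\<lbrakk>X \<in> Obj T; Y \<in> Obj T\<rbrakk> \<Longrightarrow> \<sigma> Y X \<cdot> \<sigma> X Y = \<one> (X \<otimes> Y)"

text \<open>The set \<open>B\<close> plays the role of an orthonormal basis of the Hilbert space \<open>(\<complex>,X)\<close>; its elements are
  the isometries exhibiting \<open>X\<close> as a direct sum of copies of the tensor unit \<open>\<complex>\<close>.\<close>

definition direct_sum_of_units :: "('o, 'a::complex_normed_vector, 'm) tcat_scheme \<Rightarrow> 'o \<Rightarrow> bool" where
  "direct_sum_of_units T X \<longleftrightarrow>
     (\<exists>B \<subseteq> Hom T \<U>\<^bsub>T\<^esub> X.
        (\<forall>s\<in>B. \<forall>t\<in>B. s\<^sup>\<dagger>\<^bsub>T\<^esub> \<cdot>\<^bsub>T\<^esub> t = (if s = t then \<one>\<^bsub>T\<^esub> \<U>\<^bsub>T\<^esub> else 0)) \<and>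
        (\<forall>\<phi>. normal_functional (Hom T X X) \<phi> \<longrightarrow>
           ((\<lambda>s. \<phi> (s \<cdot>\<^bsub>T\<^esub> s\<^sup>\<dagger>\<^bsub>T\<^esub>)) has_sum \<phi> (\<one>\<^bsub>T\<^esub> X)) B))"

locale hilbert_category = tensor_wstar_category T
  for T :: "('o, 'a::complex_normed_vector, 'm) tcat_scheme" (structure) +
  assumes unit_scalars: "Hom T \<U> \<U> = range (\<lambda>c. c *\<^sub>C \<one> \<U>)"
    and unit_nonzero: "\<one> \<U> \<noteq> 0"
    and units_generate: "X \<in> Obj T \<Longrightarrow> direct_sum_of_units T X"


section \<open>Functors, natural transformations, subcategories\<close>

record ('o, 'a, 'p, 'b) functor_maps =
  on_ob :: "'o \<Rightarrow> 'p"
  on_ar :: "'a \<Rightarrow> 'b"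

definition functor_comp ::
  "('p, 'b, 'q, 'c) functor_maps \<Rightarrow> ('o, 'a, 'p, 'b) functor_maps \<Rightarrow> ('o, 'a, 'q, 'c) functor_maps" where
  "functor_comp G F = \<lparr>on_ob = on_ob G \<circ> on_ob F, on_ar = on_ar G \<circ> on_ar F\<rparr>"

locale tensor_star_functor =
  fixes T :: "('o, 'a::complex_normed_vector, 'm) tcat_scheme"
    and S :: "('p, 'b::complex_normed_vector, 'n) tcat_scheme"
    and F :: "('o, 'a, 'p, 'b) functor_maps"
  assumes F_ob: "X \<in> Obj T \<Longrightarrow> on_ob F X \<in> Obj S"
    and F_in: "\<lbrakk>X \<in> Obj T; Y \<in> Obj T; f \<in> Hom T X Y\<rbrakk> \<Longrightarrow> on_ar F f \<in> Hom S (on_ob F X) (on_ob F Y)"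
    and F_id: "X \<in> Obj T \<Longrightarrow> on_ar F (\<one>\<^bsub>T\<^esub> X) = \<one>\<^bsub>S\<^esub> (on_ob F X)"
    and F_comp: "\<lbrakk>X \<in> Obj T; Y \<in> Obj T; Z \<in> Obj T; f \<in> Hom T X Y; g \<in> Hom T Y Z\<rbrakk>
      \<Longrightarrow> on_ar F (g \<cdot>\<^bsub>T\<^esub> f) = on_ar F g \<cdot>\<^bsub>S\<^esub> on_ar F f"
    and F_add: "\<lbrakk>X \<in> Obj T; Y \<in> Obj T; f \<in> Hom T X Y; g \<in> Hom T X Y\<rbrakk>
      \<Longrightarrow> on_ar F (f + g) = on_ar F f + on_ar F g"
    and F_scale: "\<lbrakk>X \<in> Obj T; Y \<in> Obj T; f \<in> Hom T X Y\<rbrakk> \<Longrightarrow> on_ar F (c *\<^sub>C f) = c *\<^sub>C on_ar F f"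
    and F_adj: "\<lbrakk>X \<in> Obj T; Y \<in> Obj T; f \<in> Hom T X Y\<rbrakk> \<Longrightarrow> on_ar F (f\<^sup>\<dagger>\<^bsub>T\<^esub>) = (on_ar F f)\<^sup>\<dagger>\<^bsub>S\<^esub>"
    and F_unit: "on_ob F \<U>\<^bsub>T\<^esub> = \<U>\<^bsub>S\<^esub>"
    and F_tens_ob: "\<lbrakk>X \<in> Obj T; Y \<in> Obj T\<rbrakk> \<Longrightarrow> on_ob F (X \<otimes>\<^bsub>T\<^esub> Y) = on_ob F X \<otimes>\<^bsub>S\<^esub> on_ob F Y"
    and F_tens: "\<lbrakk>X \<in> Obj T; Y \<in> Obj T; X' \<in> Obj T; Y' \<in> Obj T; f \<in> Hom T X Y; g \<in> Hom T X' Y'\<rbrakk>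
      \<Longrightarrow> on_ar F (f \<boxtimes>\<^bsub>T\<^esub> g) = on_ar F f \<boxtimes>\<^bsub>S\<^esub> on_ar F g"

definition faithful :: "('o, 'a, 'm) tcat_scheme \<Rightarrow> ('o, 'a, 'p, 'b) functor_maps \<Rightarrow> bool" where
  "faithful T F \<longleftrightarrow> (\<forall>X\<in>Obj T. \<forall>Y\<in>Obj T. inj_on (on_ar F) (Hom T X Y))"

definition idempotent :: "('o, 'a, 'm) tcat_scheme \<Rightarrow> ('o, 'a, 'o, 'a) functor_maps \<Rightarrow> bool" where
  "idempotent T F \<longleftrightarrow> (\<forall>X\<in>Obj T. on_ob F (on_ob F X) = on_ob F X) \<and>
     (\<forall>X\<in>Obj T. \<forall>Y\<in>Obj T. \<forall>f\<in>Hom T X Y. on_ar F (on_ar F f) = on_ar F f)"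

definition functor_image ::
  "('o, 'a, 'm) tcat_scheme \<Rightarrow> ('o, 'a, 'o, 'a) functor_maps \<Rightarrow> ('o, 'a, 'm) tcat_scheme" where
  "functor_image T F = T\<lparr>Obj := on_ob F ` Obj T,
     Hom := \<lambda>X Y. {on_ar F f | f X' Y'. X' \<in> Obj T \<and> Y' \<in> Obj T \<and> f \<in> Hom T X' Y' \<and>
                                        on_ob F X' = X \<and> on_ob F Y' = Y}\<rparr>"

definition unitary_nat_trans ::
  "('o, 'a, 'm) tcat_scheme \<Rightarrow> ('o, 'a, 'o, 'a) functor_maps \<Rightarrow> ('o, 'a, 'o, 'a) functor_maps
     \<Rightarrow> ('o \<Rightarrow> 'a) \<Rightarrow> bool" where
  "unitary_nat_trans T F G \<eta> \<longleftrightarrow>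
     (\<forall>W\<in>Obj T. unitary T (on_ob F W) (on_ob G W) (\<eta> W)) \<and>
     (\<forall>W\<in>Obj T. \<forall>W'\<in>Obj T. \<forall>f\<in>Hom T W W'. \<eta> W' \<cdot>\<^bsub>T\<^esub> on_ar F f = on_ar G f \<cdot>\<^bsub>T\<^esub> \<eta> W)"

definition tensor_subcategory ::
  "('o, 'a::complex_normed_vector) tcat \<Rightarrow> ('o, 'a) tcat \<Rightarrow> bool" where
  "tensor_subcategory S C \<longleftrightarrow>
     S = C\<lparr>Obj := Obj S, Hom := Hom S\<rparr> \<and> Obj S \<subseteq> Obj C \<and> \<U>\<^bsub>C\<^esub> \<in> Obj S \<and>
     (\<forall>X\<in>Obj S. \<forall>Y\<in>Obj S. X \<otimes>\<^bsub>C\<^esub> Y \<in> Obj S) \<and>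
     (\<forall>X\<in>Obj S. \<one>\<^bsub>C\<^esub> X \<in> Hom S X X) \<and>
     (\<forall>X\<in>Obj S. \<forall>Y\<in>Obj S. Hom S X Y \<subseteq> Hom C X Y \<and> csubspace (Hom S X Y) \<and>
        (\<forall>f\<in>Hom S X Y. f\<^sup>\<dagger>\<^bsub>C\<^esub> \<in> Hom S Y X)) \<and>
     (\<forall>X\<in>Obj S. \<forall>Y\<in>Obj S. \<forall>Z\<in>Obj S. \<forall>f\<in>Hom S X Y. \<forall>g\<in>Hom S Y Z. g \<cdot>\<^bsub>C\<^esub> f \<in> Hom S X Z) \<and>
     (\<forall>X\<in>Obj S. \<forall>Y\<in>Obj S. \<forall>X'\<in>Obj S. \<forall>Y'\<in>Obj S. \<forall>f\<in>Hom S X Y. \<forall>g\<in>Hom S X' Y'.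
        f \<boxtimes>\<^bsub>C\<^esub> g \<in> Hom S (X \<otimes>\<^bsub>C\<^esub> X') (Y \<otimes>\<^bsub>C\<^esub> Y'))"

definition tensor_star_isomorphism ::
  "('o, 'a::complex_normed_vector) tcat \<Rightarrow> ('p, 'b::complex_normed_vector) tcat
     \<Rightarrow> ('o, 'a, 'p, 'b) functor_maps \<Rightarrow> bool" where
  "tensor_star_isomorphism T S F \<longleftrightarrow>
     tensor_star_functor T S F \<and> bij_betw (on_ob F) (Obj T) (Obj S) \<and>
     (\<forall>X\<in>Obj T. \<forall>Y\<in>Obj T. bij_betw (on_ar F) (Hom T X Y) (Hom S (on_ob F X) (on_ob F Y)))"


section \<open>Multiplicative unitaries, representations and corepresentations\<close>

text \<open>These are formulated in a tensor \<open>W\<^sup>*\<close>-category \<open>C\<close> of Hilbert spaces with flip \<open>\<sigma>\<close>.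
  For \<open>U \<in> (AD, AD)\<close>, \<open>leg13 C \<sigma> A B D U\<close> is \<open>U\<^sub>1\<^sub>3 \<in> (ABD, ABD)\<close>.\<close>

definition leg13 :: "('o, 'a) tcat \<Rightarrow> ('o \<Rightarrow> 'o \<Rightarrow> 'a) \<Rightarrow> 'o \<Rightarrow> 'o \<Rightarrow> 'o \<Rightarrow> 'a \<Rightarrow> 'a" where
  "leg13 C \<sigma> A B D U =
     (\<one>\<^bsub>C\<^esub> A \<boxtimes>\<^bsub>C\<^esub> \<sigma> D B) \<cdot>\<^bsub>C\<^esub> (U \<boxtimes>\<^bsub>C\<^esub> \<one>\<^bsub>C\<^esub> B) \<cdot>\<^bsub>C\<^esub> (\<one>\<^bsub>C\<^esub> A \<boxtimes>\<^bsub>C\<^esub> \<sigma> B D)"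

definition multiplicative_unitary :: "('o, 'a) tcat \<Rightarrow> ('o \<Rightarrow> 'o \<Rightarrow> 'a) \<Rightarrow> 'o \<Rightarrow> 'a \<Rightarrow> bool" where
  "multiplicative_unitary C \<sigma> K V \<longleftrightarrow>
     K \<in> Obj C \<and> unitary C (K \<otimes>\<^bsub>C\<^esub> K) (K \<otimes>\<^bsub>C\<^esub> K) V \<and>
     (V \<boxtimes>\<^bsub>C\<^esub> \<one>\<^bsub>C\<^esub> K) \<cdot>\<^bsub>C\<^esub> leg13 C \<sigma> K K K V \<cdot>\<^bsub>C\<^esub> (\<one>\<^bsub>C\<^esub> K \<boxtimes>\<^bsub>C\<^esub> V)
       = (\<one>\<^bsub>C\<^esub> K \<boxtimes>\<^bsub>C\<^esub> V) \<cdot>\<^bsub>C\<^esub> (V \<boxtimes>\<^bsub>C\<^esub> \<one>\<^bsub>C\<^esub> K)"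

definition representation :: "('o, 'a) tcat \<Rightarrow> ('o \<Rightarrow> 'o \<Rightarrow> 'a) \<Rightarrow> 'o \<Rightarrow> 'a \<Rightarrow> 'o \<Rightarrow> 'a \<Rightarrow> bool" where
  "representation C \<sigma> K V H W \<longleftrightarrow>
     H \<in> Obj C \<and> unitary C (H \<otimes>\<^bsub>C\<^esub> K) (H \<otimes>\<^bsub>C\<^esub> K) W \<and>
     (W \<boxtimes>\<^bsub>C\<^esub> \<one>\<^bsub>C\<^esub> K) \<cdot>\<^bsub>C\<^esub> leg13 C \<sigma> H K K W \<cdot>\<^bsub>C\<^esub> (\<one>\<^bsub>C\<^esub> H \<boxtimes>\<^bsub>C\<^esub> V)
       = (\<one>\<^bsub>C\<^esub> H \<boxtimes>\<^bsub>C\<^esub> V) \<cdot>\<^bsub>C\<^esub> (W \<boxtimes>\<^bsub>C\<^esub> \<one>\<^bsub>C\<^esub> K)"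

definition corepresentation :: "('o, 'a) tcat \<Rightarrow> ('o \<Rightarrow> 'o \<Rightarrow> 'a) \<Rightarrow> 'o \<Rightarrow> 'a \<Rightarrow> 'o \<Rightarrow> 'a \<Rightarrow> bool" where
  "corepresentation C \<sigma> K V H W \<longleftrightarrow>
     H \<in> Obj C \<and> unitary C (K \<otimes>\<^bsub>C\<^esub> H) (K \<otimes>\<^bsub>C\<^esub> H) W \<and>
     (V \<boxtimes>\<^bsub>C\<^esub> \<one>\<^bsub>C\<^esub> H) \<cdot>\<^bsub>C\<^esub> leg13 C \<sigma> K K H W \<cdot>\<^bsub>C\<^esub> (\<one>\<^bsub>C\<^esub> K \<boxtimes>\<^bsub>C\<^esub> W)
       = (\<one>\<^bsub>C\<^esub> K \<boxtimes>\<^bsub>C\<^esub> W) \<cdot>\<^bsub>C\<^esub> (V \<boxtimes>\<^bsub>C\<^esub> \<one>\<^bsub>C\<^esub> H)"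

text \<open>An object of \<open>\<R>(V)\<close> or \<open>\<C>(V)\<close> is a pair \<open>(H, W)\<close> of a Hilbert space and a (co)representation
  on it.\<close>

definition rep_category ::
  "('o, 'a) tcat \<Rightarrow> ('o \<Rightarrow> 'o \<Rightarrow> 'a) \<Rightarrow> 'o \<Rightarrow> 'a \<Rightarrow> ('o \<times> 'a, 'a) tcat" where
  "rep_category C \<sigma> K V =
     \<lparr>Obj = {(H, W). representation C \<sigma> K V H W},
      Hom = (\<lambda>(H, W) (H', W'). {t \<in> Hom C H H'.
               (t \<boxtimes>\<^bsub>C\<^esub> \<one>\<^bsub>C\<^esub> K) \<cdot>\<^bsub>C\<^esub> W = W' \<cdot>\<^bsub>C\<^esub> (t \<boxtimes>\<^bsub>C\<^esub> \<one>\<^bsub>C\<^esub> K)}),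
      Id = (\<lambda>(H, W). \<one>\<^bsub>C\<^esub> H), Comp = Comp C, Adj = Adj C,
      Unit = (\<U>\<^bsub>C\<^esub>, \<one>\<^bsub>C\<^esub> K),
      TensOb = (\<lambda>(H, W) (H', W'). (H \<otimes>\<^bsub>C\<^esub> H', leg13 C \<sigma> H H' K W \<cdot>\<^bsub>C\<^esub> (\<one>\<^bsub>C\<^esub> H \<boxtimes>\<^bsub>C\<^esub> W'))),
      TensAr = TensAr C\<rparr>"

definition corep_category ::
  "('o, 'a) tcat \<Rightarrow> ('o \<Rightarrow> 'o \<Rightarrow> 'a) \<Rightarrow> 'o \<Rightarrow> 'a \<Rightarrow> ('o \<times> 'a, 'a) tcat" where
  "corep_category C \<sigma> K V =
     \<lparr>Obj = {(H, W). corepresentation C \<sigma> K V H W},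
      Hom = (\<lambda>(H, W) (H', W'). {t \<in> Hom C H H'.
               (\<one>\<^bsub>C\<^esub> K \<boxtimes>\<^bsub>C\<^esub> t) \<cdot>\<^bsub>C\<^esub> W = W' \<cdot>\<^bsub>C\<^esub> (\<one>\<^bsub>C\<^esub> K \<boxtimes>\<^bsub>C\<^esub> t)}),
      Id = (\<lambda>(H, W). \<one>\<^bsub>C\<^esub> H), Comp = Comp C, Adj = Adj C,
      Unit = (\<U>\<^bsub>C\<^esub>, \<one>\<^bsub>C\<^esub> K),
      TensOb = (\<lambda>(H, W) (H', W'). (H \<otimes>\<^bsub>C\<^esub> H', (W \<boxtimes>\<^bsub>C\<^esub> \<one>\<^bsub>C\<^esub> H') \<cdot>\<^bsub>C\<^esub> leg13 C \<sigma> K H H' W')),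
      TensAr = TensAr C\<rparr>"


section \<open>The functor \<open>\<iota>\<close> and regular objects\<close>

text \<open>\<open>\<theta> X Y\<close> is the arrow \<open>\<vartheta>\<^bsub>X,Y\<^esub>\<close>; it is relevant only when \<open>X\<close> or \<open>Y\<close> is in the image of \<open>\<iota>\<close>.\<close>

locale hilbert_functor = tensor_wstar_category T + tensor_star_functor T T \<iota>
  for T :: "('o, 'a::complex_normed_vector) tcat" (structure)
    and \<iota> :: "('o, 'a, 'o, 'a) functor_maps" and \<theta> :: "'o \<Rightarrow> 'o \<Rightarrow> 'a" +
  assumes iota_faithful: "faithful T \<iota>"
    and iota_idem: "idempotent T \<iota>"
    and image_hilbert: "hilbert_category (functor_image T \<iota>)"
    and image_symmetry: "permutation_symmetry (functor_image T \<iota>) \<theta>"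
    and theta_right: "\<lbrakk>W \<in> Obj T; W' \<in> Obj T\<rbrakk> \<Longrightarrow>
      \<theta> W (on_ob \<iota> W') \<in> Hom T (W \<otimes> on_ob \<iota> W') (on_ob \<iota> W' \<otimes> W) \<and>
      on_ar \<iota> (\<theta> W (on_ob \<iota> W')) = \<theta> (on_ob \<iota> W) (on_ob \<iota> W')"
    and theta_left: "\<lbrakk>W \<in> Obj T; W' \<in> Obj T\<rbrakk> \<Longrightarrow>
      \<theta> (on_ob \<iota> W) W' \<in> Hom T (on_ob \<iota> W \<otimes> W') (W' \<otimes> on_ob \<iota> W) \<and>
      on_ar \<iota> (\<theta> (on_ob \<iota> W) W') = \<theta> (on_ob \<iota> W) (on_ob \<iota> W')"

definition left_tensor :: "('o, 'a) tcat \<Rightarrow> 'o \<Rightarrow> ('o, 'a, 'o, 'a) functor_maps" where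
  "left_tensor T V = \<lparr>on_ob = (\<lambda>W. V \<otimes>\<^bsub>T\<^esub> W), on_ar = (\<lambda>f. \<one>\<^bsub>T\<^esub> V \<boxtimes>\<^bsub>T\<^esub> f)\<rparr>"

definition right_tensor :: "('o, 'a) tcat \<Rightarrow> 'o \<Rightarrow> ('o, 'a, 'o, 'a) functor_maps" where
  "right_tensor T V = \<lparr>on_ob = (\<lambda>W. W \<otimes>\<^bsub>T\<^esub> V), on_ar = (\<lambda>f. f \<boxtimes>\<^bsub>T\<^esub> \<one>\<^bsub>T\<^esub> V)\<rparr>"

definition right_regular ::
  "('o, 'a) tcat \<Rightarrow> ('o, 'a, 'o, 'a) functor_maps \<Rightarrow> ('o \<Rightarrow> 'o \<Rightarrow> 'a) \<Rightarrow> 'o \<Rightarrow> ('o \<Rightarrow> 'a) \<Rightarrow> bool" where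
  "right_regular T \<iota> \<theta> V \<eta> \<longleftrightarrow>
     unitary_nat_trans T (right_tensor T V) (functor_comp (right_tensor T V) \<iota>) \<eta> \<and>
     (\<forall>W\<in>Obj T. \<forall>W'\<in>Obj T.
        \<eta> (W \<otimes>\<^bsub>T\<^esub> W') =
          ((\<one>\<^bsub>T\<^esub> (on_ob \<iota> W) \<boxtimes>\<^bsub>T\<^esub> \<theta> V (on_ob \<iota> W')) \<cdot>\<^bsub>T\<^esub> (\<eta> W \<boxtimes>\<^bsub>T\<^esub> \<one>\<^bsub>T\<^esub> (on_ob \<iota> W'))
             \<cdot>\<^bsub>T\<^esub> (\<one>\<^bsub>T\<^esub> W \<boxtimes>\<^bsub>T\<^esub> \<theta> (on_ob \<iota> W') V)) \<cdot>\<^bsub>T\<^esub> (\<one>\<^bsub>T\<^esub> W \<boxtimes>\<^bsub>T\<^esub> \<eta> W'))"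

definition left_regular ::
  "('o, 'a) tcat \<Rightarrow> ('o, 'a, 'o, 'a) functor_maps \<Rightarrow> ('o \<Rightarrow> 'o \<Rightarrow> 'a) \<Rightarrow> ('o \<Rightarrow> 'a) \<Rightarrow> 'o \<Rightarrow> bool" where
  "left_regular T \<iota> \<theta> \<xi> V \<longleftrightarrow>
     unitary_nat_trans T (left_tensor T V) (functor_comp (left_tensor T V) \<iota>) \<xi> \<and>
     (\<forall>W\<in>Obj T. \<forall>W'\<in>Obj T.
        \<xi> (W \<otimes>\<^bsub>T\<^esub> W') =
          ((\<theta> (on_ob \<iota> W) V \<boxtimes>\<^bsub>T\<^esub> \<one>\<^bsub>T\<^esub> (on_ob \<iota> W')) \<cdot>\<^bsub>T\<^esub> (\<one>\<^bsub>T\<^esub> (on_ob \<iota> W) \<boxtimes>\<^bsub>T\<^esub> \<xi> W')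
             \<cdot>\<^bsub>T\<^esub> (\<theta> V (on_ob \<iota> W) \<boxtimes>\<^bsub>T\<^esub> \<one>\<^bsub>T\<^esub> W')) \<cdot>\<^bsub>T\<^esub> (\<xi> W \<boxtimes>\<^bsub>T\<^esub> \<one>\<^bsub>T\<^esub> W'))"

definition regular_object ::
  "('o, 'a) tcat \<Rightarrow> ('o, 'a, 'o, 'a) functor_maps \<Rightarrow> ('o \<Rightarrow> 'o \<Rightarrow> 'a)
     \<Rightarrow> ('o \<Rightarrow> 'a) \<Rightarrow> 'o \<Rightarrow> ('o \<Rightarrow> 'a) \<Rightarrow> bool" where
  "regular_object T \<iota> \<theta> \<xi> V \<eta> \<longleftrightarrow>
     V \<in> Obj T \<and> left_regular T \<iota> \<theta> \<xi> V \<and> right_regular T \<iota> \<theta> V \<eta> \<and>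
     (\<forall>W\<in>Obj T. \<forall>W'\<in>Obj T.
        (\<eta> W \<boxtimes>\<^bsub>T\<^esub> \<one>\<^bsub>T\<^esub> (on_ob \<iota> W')) \<cdot>\<^bsub>T\<^esub> (\<one>\<^bsub>T\<^esub> W \<boxtimes>\<^bsub>T\<^esub> \<xi> W')
          = (\<one>\<^bsub>T\<^esub> (on_ob \<iota> W) \<boxtimes>\<^bsub>T\<^esub> \<xi> W') \<cdot>\<^bsub>T\<^esub> (\<eta> W \<boxtimes>\<^bsub>T\<^esub> \<one>\<^bsub>T\<^esub> W'))"

definition braided_symmetry :: "('o, 'a) tcat \<Rightarrow> 'o \<Rightarrow> ('o \<Rightarrow> 'a) \<Rightarrow> bool" where
  "braided_symmetry T V \<epsilon> \<longleftrightarrow>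
     unitary_nat_trans T (right_tensor T V) (left_tensor T V) \<epsilon> \<and>
     (\<forall>W\<in>Obj T. \<forall>W'\<in>Obj T.
        \<epsilon> (W \<otimes>\<^bsub>T\<^esub> W') = (\<epsilon> W \<boxtimes>\<^bsub>T\<^esub> \<one>\<^bsub>T\<^esub> W') \<cdot>\<^bsub>T\<^esub> (\<one>\<^bsub>T\<^esub> W \<boxtimes>\<^bsub>T\<^esub> \<epsilon> W'))"

definition standard_braided_symmetry ::
  "('o, 'a) tcat \<Rightarrow> ('o, 'a, 'o, 'a) functor_maps \<Rightarrow> ('o \<Rightarrow> 'o \<Rightarrow> 'a)
     \<Rightarrow> ('o \<Rightarrow> 'a) \<Rightarrow> 'o \<Rightarrow> ('o \<Rightarrow> 'a) \<Rightarrow> ('o \<Rightarrow> 'a) \<Rightarrow> bool" where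
  "standard_braided_symmetry T \<iota> \<theta> \<xi> V \<eta> \<epsilon> \<longleftrightarrow>
     braided_symmetry T V \<epsilon> \<and> regular_object T \<iota> \<theta> \<xi> V \<eta> \<and>
     (\<forall>W\<in>Obj T. \<xi> W \<cdot>\<^bsub>T\<^esub> \<epsilon> W = \<theta> (on_ob \<iota> W) V \<cdot>\<^bsub>T\<^esub> \<eta> W)"


section \<open>The category of Hilbert spaces underlying \<open>T\<close>\<close>

text \<open>The functor \<open>\<iota>\<close> need not be injective on objects, whereas an isomorphism with a subcategory of
  \<open>\<R>(V)\<close> has to be, so that different objects have to be represented on different copies of the
  same Hilbert space. In the following category of Hilbert spaces an object \<open>X\<close> of \<open>T\<close> stands for a
  copy of the Hilbert space \<open>\<iota>(X)\<close>; it contains \<open>\<iota>(T)\<close> as a full tensor subcategory, on which its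
  flip \<open>hilbert_flip\<close> is \<open>\<theta>\<close>.\<close>

definition hilbert_copies :: "('o, 'a) tcat \<Rightarrow> ('o, 'a, 'o, 'a) functor_maps \<Rightarrow> ('o, 'a) tcat" where
  "hilbert_copies T \<iota> = T\<lparr>Hom := \<lambda>X Y. Hom T (on_ob \<iota> X) (on_ob \<iota> Y), Id := \<lambda>X. Id T (on_ob \<iota> X)\<rparr>"

definition hilbert_flip :: "('o, 'a, 'o, 'a) functor_maps \<Rightarrow> ('o \<Rightarrow> 'o \<Rightarrow> 'a) \<Rightarrow> 'o \<Rightarrow> 'o \<Rightarrow> 'a" where
  "hilbert_flip \<iota> \<theta> X Y = \<theta> (on_ob \<iota> X) (on_ob \<iota> Y)"

context hilbert_functor
begin

lemma image_simps:
  "Obj (functor_image T \<iota>) = on_ob \<iota> ` Obj T" "Id (functor_image T \<iota>) = Id T"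
  "Comp (functor_image T \<iota>) = Comp T" "Adj (functor_image T \<iota>) = Adj T"
  "Unit (functor_image T \<iota>) = Unit T" "TensOb (functor_image T \<iota>) = TensOb T"
  "TensAr (functor_image T \<iota>) = TensAr T"
  by (simp_all add: functor_image_def)

lemma copies_simps:
  "Obj (hilbert_copies T \<iota>) = Obj T"
  "Hom (hilbert_copies T \<iota>) = (\<lambda>X Y. Hom T (on_ob \<iota> X) (on_ob \<iota> Y))"
  "Id (hilbert_copies T \<iota>) = (\<lambda>X. \<one> (on_ob \<iota> X))"
  "Comp (hilbert_copies T \<iota>) = Comp T" "Adj (hilbert_copies T \<iota>) = Adj T"
  "Unit (hilbert_copies T \<iota>) = Unit T" "TensOb (hilbert_copies T \<iota>) = TensOb T"
  "TensAr (hilbert_copies T \<iota>) = TensAr T"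
  by (simp_all add: hilbert_copies_def)

lemma iota_iota: "X \<in> Obj T \<Longrightarrow> on_ob \<iota> (on_ob \<iota> X) = on_ob \<iota> X"
  using iota_idem by (simp add: idempotent_def)

lemma iota_fixes:
  assumes "X \<in> Obj T" "Y \<in> Obj T" "t \<in> Hom T (on_ob \<iota> X) (on_ob \<iota> Y)"
  shows "on_ar \<iota> t = t"
proof -
  have X: "on_ob \<iota> X \<in> Obj T" "on_ob \<iota> Y \<in> Obj T" using F_ob assms by auto
  have "on_ar \<iota> t \<in> Hom T (on_ob \<iota> X) (on_ob \<iota> Y)"
    using F_in[OF X assms(3)] assms by (simp add: iota_iota)
  moreover have "on_ar \<iota> (on_ar \<iota> t) = on_ar \<iota> t"
    using iota_idem X assms(3) unfolding idempotent_def by blast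
  ultimately show ?thesis
    using iota_faithful X assms(3) unfolding faithful_def inj_on_def by blast
qed

lemma image_hom:
  assumes "X \<in> Obj T" "Y \<in> Obj T"
  shows "Hom (functor_image T \<iota>) (on_ob \<iota> X) (on_ob \<iota> Y) = Hom T (on_ob \<iota> X) (on_ob \<iota> Y)"
proof
  show "Hom (functor_image T \<iota>) (on_ob \<iota> X) (on_ob \<iota> Y) \<subseteq> Hom T (on_ob \<iota> X) (on_ob \<iota> Y)"
    using F_in by (fastforce simp: functor_image_def)
  show "Hom T (on_ob \<iota> X) (on_ob \<iota> Y) \<subseteq> Hom (functor_image T \<iota>) (on_ob \<iota> X) (on_ob \<iota> Y)"
  proof
    fix t assume t: "t \<in> Hom T (on_ob \<iota> X) (on_ob \<iota> Y)"
    then have e: "on_ar \<iota> t = t" using iota_fixes assms by simp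
    show "t \<in> Hom (functor_image T \<iota>) (on_ob \<iota> X) (on_ob \<iota> Y)"
      using t e assms F_ob iota_iota
      by (simp add: functor_image_def)
        (rule exI[of _ t], simp, rule exI[of _ "on_ob \<iota> X"], simp, rule exI[of _ "on_ob \<iota> Y"], simp)
  qed
qed

lemma hilbert_copies_hilbert: "hilbert_category (hilbert_copies T \<iota>)"
proof -
  interpret I: hilbert_category "functor_image T \<iota>" by (rule image_hilbert)
  have U: "on_ob \<iota> \<U> = \<U>" by (rule F_unit)
  have UU: "Hom (functor_image T \<iota>) \<U> \<U> = Hom T \<U> \<U>"
    using image_hom[OF unit_ob unit_ob] by (simp add: U)
  show ?thesis
  proof (unfold_locales, unfold copies_simps)
    fix X assume X: "X \<in> Obj T"
    have h: "Hom (functor_image T \<iota>) \<U> (on_ob \<iota> X) = Hom T \<U> (on_ob \<iota> X)"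
      using image_hom[OF unit_ob X] by (simp add: U)
    have "direct_sum_of_units (functor_image T \<iota>) (on_ob \<iota> X)"
      using X by (intro I.units_generate) (simp add: image_simps)
    then show "direct_sum_of_units (hilbert_copies T \<iota>) X"
      unfolding direct_sum_of_units_def image_simps copies_simps image_hom[OF X X] U h .
  next
    show "Hom T (on_ob \<iota> \<U>) (on_ob \<iota> \<U>) = range (\<lambda>c. c *\<^sub>C \<one> (on_ob \<iota> \<U>))"
      using I.unit_scalars by (simp add: U UU image_simps)
  next
    show "\<one> (on_ob \<iota> \<U>) \<noteq> 0"
      using I.unit_nonzero by (simp add: U image_simps)
  qed ((simp only: F_tens_ob U)?, ((rule id_in[OF F_ob] | rule comp_in[OF F_ob F_ob F_ob] | 
      rule comp_assoc[OF F_ob F_ob F_ob F_ob] | rule id_left[OF F_ob F_ob] | 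
      rule id_right[OF F_ob F_ob] | rule hom_subspace[OF F_ob F_ob] | 
      rule hom_complete[OF F_ob F_ob] | rule comp_add_left[OF F_ob F_ob F_ob] | 
      rule comp_add_right[OF F_ob F_ob F_ob] | rule comp_scale_left[OF F_ob F_ob F_ob] | 
      rule comp_scale_right[OF F_ob F_ob F_ob] | rule adj_in[OF F_ob F_ob] | 
      rule adj_adj[OF F_ob F_ob] | rule adj_comp[OF F_ob F_ob F_ob] | 
      rule adj_add[OF F_ob F_ob] | rule adj_scale[OF F_ob F_ob] | 
      rule norm_comp[OF F_ob F_ob F_ob] | rule cstar_identity[OF F_ob F_ob] | 
      rule adj_comp_pos[OF F_ob F_ob] | rule hom_predual[OF F_ob F_ob] | rule unit_ob | 
      rule tens_ob | rule tens_ob_assoc | rule unit_tens_ob | rule tens_ob_unit | 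
      rule tens_in[OF F_ob F_ob F_ob F_ob] | rule tens_assoc[OF F_ob F_ob F_ob F_ob F_ob F_ob] | 
      rule unit_tens[OF F_ob F_ob] | rule tens_unit[OF F_ob F_ob] | rule tens_id[OF F_ob F_ob] | 
      rule tens_comp[OF F_ob F_ob F_ob F_ob F_ob F_ob] | 
      rule tens_add_left[OF F_ob F_ob F_ob F_ob] | rule tens_add_right[OF F_ob F_ob F_ob F_ob] | 
      rule tens_scale_left[OF F_ob F_ob F_ob F_ob] | 
      rule tens_scale_right[OF F_ob F_ob F_ob F_ob] | rule tens_adj[OF F_ob F_ob F_ob F_ob] | 
      rule tens_normal_left[OF F_ob F_ob F_ob F_ob] | 
      rule tens_normal_right[OF F_ob F_ob F_ob F_ob]); assumption))+
qed

lemma hilbert_copies_symmetry: "permutation_symmetry (hilbert_copies T \<iota>) (hilbert_flip \<iota> \<theta>)"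
proof -
  interpret S: permutation_symmetry "functor_image T \<iota>" \<theta> by (rule image_symmetry)
  have hom: "Hom (functor_image T \<iota>) A B = Hom T A B"
    if "A \<in> on_ob \<iota> ` Obj T" "B \<in> on_ob \<iota> ` Obj T" for A B
    using that image_hom by auto
  have tens: "A \<otimes> B \<in> on_ob \<iota> ` Obj T" if "A \<in> on_ob \<iota> ` Obj T" "B \<in> on_ob \<iota> ` Obj T" for A B
  proof -
    from that obtain X Y where "X \<in> Obj T" "A = on_ob \<iota> X" "Y \<in> Obj T" "B = on_ob \<iota> Y" by auto
    then show ?thesis using imageI[OF tens_ob, of X Y "on_ob \<iota>"] by (simp add: F_tens_ob)
  qed
  show ?thesis
  proof (unfold_locales, unfold copies_simps hilbert_flip_def)
    fix X Y assume X: "X \<in> Obj T" and Y: "Y \<in> Obj T"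
    show "unitary (hilbert_copies T \<iota>) (X \<otimes> Y) (Y \<otimes> X) (\<theta> (on_ob \<iota> X) (on_ob \<iota> Y))"
      using S.sym_unitary[of "on_ob \<iota> X" "on_ob \<iota> Y"] X Y
      by (simp add: unitary_def image_simps copies_simps hom tens F_tens_ob)
    show "\<theta> (on_ob \<iota> Y) (on_ob \<iota> X) \<cdot> \<theta> (on_ob \<iota> X) (on_ob \<iota> Y) = \<one> (on_ob \<iota> (X \<otimes> Y))"
      using S.sym_sym[of "on_ob \<iota> X" "on_ob \<iota> Y"] X Y by (simp add: image_simps F_tens_ob)
  next
    fix X Y X' Y' f g
    assume "X \<in> Obj T" "Y \<in> Obj T" "X' \<in> Obj T" "Y' \<in> Obj T"
      "f \<in> Hom T (on_ob \<iota> X) (on_ob \<iota> X')" "g \<in> Hom T (on_ob \<iota> Y) (on_ob \<iota> Y')"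
    then show "\<theta> (on_ob \<iota> X') (on_ob \<iota> Y') \<cdot> (f \<boxtimes> g) = (g \<boxtimes> f) \<cdot> \<theta> (on_ob \<iota> X) (on_ob \<iota> Y)"
      using S.sym_natural[of "on_ob \<iota> X" "on_ob \<iota> Y" "on_ob \<iota> X'" "on_ob \<iota> Y'" f g]
      by (simp add: image_simps hom)
  next
    fix X Y Z assume "X \<in> Obj T" "Y \<in> Obj T" "Z \<in> Obj T"
    then show "\<theta> (on_ob \<iota> (X \<otimes> Y)) (on_ob \<iota> Z) =
        (\<theta> (on_ob \<iota> X) (on_ob \<iota> Z) \<boxtimes> \<one> (on_ob \<iota> Y)) \<cdot> (\<one> (on_ob \<iota> X) \<boxtimes> \<theta> (on_ob \<iota> Y) (on_ob \<iota> Z))"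
      using S.sym_tens[of "on_ob \<iota> X" "on_ob \<iota> Y" "on_ob \<iota> Z"]
      by (simp add: image_simps F_tens_ob)
  qed
qed

end

end

theory Submission
  imports Defs
begin

text \<open>Naturality of \<open>\<eta>\<close> on the arrow \<open>\<eta>\<^bsub>W\<^esub>\<close>, together with the tensor formula for \<open>\<eta>\<close>, is the
  defining identity of a representation as soon as \<open>\<eta>\<close> is trivial on the image of \<open>\<iota>\<close>; similarly
  for \<open>\<xi>\<close>. The tensor formula makes \<open>\<eta>\<close> at the tensor unit an idempotent unitary, hence trivial, so
  by naturality \<open>\<eta>\<close> at a Hilbert space fixes the orthogonal projections \<open>ss\<^sup>* \<times> 1\<close>, with \<open>s\<close> in an
  orthonormal basis. These sum to \<open>1\<close> weakly with respect to a predual, which forces \<open>\<eta>\<close> to be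
  trivial there. The braiding is then a diagram chase with the tensor formulas and the compatibility
  of \<open>\<xi>\<close> with \<open>\<eta>\<close>.\<close>

section \<open>Orthogonal resolutions of the identity\<close>

text \<open>The obstacle is that composition is not assumed weakly continuous, so a weakly
  convergent sum of projections cannot be multiplied by \<open>\<eta>\<close> term by term. The way
  round it is a norm argument. Suppose the difference of \<open>\<eta>\<close> and \<open>1\<close>
  at a Hilbert space is nonzero and let \<open>b\<close> be its multiple of norm 1. Every projection
  annihilates \<open>b\<close> from both sides, so \<open>b\<close> and \<open>-b\<close> plus
  finite sums of projections stay small in norm, and a weak limit cannot exceed such a bound. Then
  \<open>1 + b\<close> and \<open>1 - b\<close> are small too, although \<open>1\<close> is their
  midpoint. With the sharp bound 1 this is the fact that the identity is an extreme point of the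
  unit ball; a cruder bound is easier to prove and still suffices. Tensoring with \<open>V\<close>,
  unlike composing, is normal, and so it carries a resolution of the identity of a Hilbert space to
  one of the tensor product.\<close>

lemma scaleC_minus_one: "(- 1) *\<^sub>C x = - (x::'a::complex_normed_vector)"
  using scaleR_scaleC[of "- 1" x] by simp

lemma scaleC_zero: "0 *\<^sub>C x = (0::'a::complex_normed_vector)"
  using scaleR_scaleC[of 0 x] by simp

lemma csubspace_uminus: "csubspace E \<Longrightarrow> x \<in> E \<Longrightarrow> - x \<in> E"
  unfolding csubspace_def by (metis scaleC_minus_one)

lemma csubspace_sum:
  assumes "csubspace E" "finite F" "\<And>s. s \<in> F \<Longrightarrow> p s \<in> E"
  shows "sum p F \<in> E"
  using assms(2,3) by (induction F rule: finite_induct) (use assms(1) in \<open>auto simp: csubspace_def\<close>)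

lemma bounded_functional_sum:
  assumes "csubspace E" "bounded_functional E \<phi>" "finite F" "\<And>s. s \<in> F \<Longrightarrow> p s \<in> E"
  shows "\<phi> (sum p F) = (\<Sum>s\<in>F. \<phi> (p s))"
  using assms(3,4)
proof (induction F rule: finite_induct)
  case empty
  have "\<phi> (0 *\<^sub>C 0) = 0 * \<phi> 0"
    using assms(1,2) unfolding bounded_functional_def csubspace_def by blast
  then show ?case by (simp add: scaleC_zero)
next
  case (insert s F)
  then have "sum p F \<in> E" "p s \<in> E" using assms(1) by (auto intro: csubspace_sum)
  then show ?case using insert assms(2) by (simp add: bounded_functional_def)
qed

text \<open>Dividing by \<open>c\<close> instead of by \<open>norm x\<close> brings \<open>x\<close>
  into the unit ball without a separate case \<open>x = 0\<close>.\<close>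

lemma bounded_functional_le:
  assumes E: "csubspace E" and \<phi>: "bounded_functional E \<phi>"
    and "dual_norm E \<phi> \<le> 1" and x: "x \<in> E" "norm x \<le> c" and c: "c > 0"
  shows "cmod (\<phi> x) \<le> c"
proof -
  let ?y = "complex_of_real (1 / c) *\<^sub>C x"
  obtain M where M: "\<And>x. x \<in> E \<Longrightarrow> cmod (\<phi> x) \<le> M * norm x"
    using \<phi> unfolding bounded_functional_def by blast
  \<comment> \<open>A supremum dominates its members only if they are bounded above; the absolute
    value is taken because \<open>M\<close> may be negative.\<close>
  have "cmod (\<phi> z) \<le> \<bar>M\<bar>" if "z \<in> E" "norm z \<le> 1" for z
  proof -
    have "M * norm z \<le> \<bar>M\<bar> * 1" using that by (intro mult_mono) auto
    then show ?thesis using M[OF that(1)] by simp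
  qed
  then have "bdd_above ((\<lambda>x. cmod (\<phi> x)) ` {x \<in> E. norm x \<le> 1})"
    by (intro bdd_aboveI[of _ "\<bar>M\<bar>"]) auto
  moreover have "?y \<in> {x \<in> E. norm x \<le> 1}"
    using E x c by (simp add: csubspace_def norm_scaleC norm_divide)
  ultimately have "cmod (\<phi> ?y) \<le> 1"
    using assms(3) unfolding dual_norm_def by (meson cSUP_upper order_trans)
  moreover have "\<phi> ?y = complex_of_real (1 / c) * \<phi> x"
    using \<phi> x unfolding bounded_functional_def by blast
  then have "cmod (\<phi> ?y) = cmod (\<phi> x) / c"
    using c by (simp only: norm_mult norm_of_real) simp
  ultimately have "cmod (\<phi> x) / c \<le> 1" by simp
  then show ?thesis using c by simp
qed

text \<open>This is what lets norm bounds pass to weak limits: it is enough to bound each functional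
  in the unit ball of the predual.\<close>

lemma predual_norm_le:
  assumes "predual E P" "x \<in> E" and "\<And>\<phi>. \<phi> \<in> P \<Longrightarrow> dual_norm E \<phi> \<le> 1 \<Longrightarrow> cmod (\<phi> x) \<le> c"
    and "csubspace E"
  shows "norm x \<le> c"
proof -
  have "norm x = (SUP \<phi>\<in>{\<phi> \<in> P. dual_norm E \<phi> \<le> 1}. cmod (\<phi> x))"
    using assms(1,2) unfolding predual_def by blast
  also have "\<dots> \<le> c"
  proof (rule cSUP_least)
    \<comment> \<open>The supremum must range over a nonempty set; the zero functional is a
      member.\<close>
    have "dual_norm E (\<lambda>x. 0) = 0"
      unfolding dual_norm_def using assms(4)
      by (subst cSUP_const) (auto simp: csubspace_def intro!: exI[of _ 0])
    moreover have "(\<lambda>x. 0) \<in> P" using assms(1) unfolding predual_def by blast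
    ultimately show "{\<phi> \<in> P. dual_norm E \<phi> \<le> 1} \<noteq> {}" by auto
  qed (use assms(3) in auto)
  finally show ?thesis .
qed

section \<open>Norm estimates in a \<open>C*\<close>-category\<close>

context cstar_category
begin

lemma
  assumes "X \<in> Obj T" "Y \<in> Obj T"
  shows zero_in: "0 \<in> Hom T X Y"
    and add_in: "f \<in> Hom T X Y \<Longrightarrow> g \<in> Hom T X Y \<Longrightarrow> f + g \<in> Hom T X Y"
    and scale_in: "f \<in> Hom T X Y \<Longrightarrow> c *\<^sub>C f \<in> Hom T X Y"
    and uminus_in: "f \<in> Hom T X Y \<Longrightarrow> - f \<in> Hom T X Y"
  using hom_subspace[OF assms] csubspace_uminus by (auto simp: csubspace_def)

lemma comp_zero_left:
  assumes "X \<in> Obj T" "Y \<in> Obj T" "Z \<in> Obj T" "f \<in> Hom T X Y"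
  shows "0 \<cdot> f = 0"
  using comp_scale_left[OF assms zero_in[OF assms(2,3)], of 0] by (simp add: scaleC_zero)

lemma comp_zero_right:
  assumes "X \<in> Obj T" "Y \<in> Obj T" "Z \<in> Obj T" "g \<in> Hom T Y Z"
  shows "g \<cdot> 0 = 0"
  using comp_scale_right[OF assms(1-3) zero_in[OF assms(1,2)] assms(4), of 0] by (simp add: scaleC_zero)

lemma adj_zero:
  assumes "X \<in> Obj T" "Y \<in> Obj T"
  shows "0\<^sup>\<dagger> = 0"
  using adj_scale[OF assms zero_in[OF assms], of 0] by (simp add: scaleC_zero)

lemma comp_uminus_left:
  assumes "X \<in> Obj T" "Y \<in> Obj T" "Z \<in> Obj T" "f \<in> Hom T X Y" "g \<in> Hom T Y Z"
  shows "(- g) \<cdot> f = - (g \<cdot> f)"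
  using comp_scale_left[OF assms, of "- 1"] by (simp add: scaleC_minus_one)

lemma comp_uminus_right:
  assumes "X \<in> Obj T" "Y \<in> Obj T" "Z \<in> Obj T" "f \<in> Hom T X Y" "g \<in> Hom T Y Z"
  shows "g \<cdot> (- f) = - (g \<cdot> f)"
  using comp_scale_right[OF assms, of "- 1"] by (simp add: scaleC_minus_one)

text \<open>The product of the identity with its adjoint is self-adjoint, and it equals that
  adjoint.\<close>

lemma id_adj:
  assumes "X \<in> Obj T" shows "(\<one> X)\<^sup>\<dagger> = \<one> X"
proof -
  note i = id_in[OF assms]
  note j = adj_in[OF assms assms i]
  have "(\<one> X \<cdot> (\<one> X)\<^sup>\<dagger>)\<^sup>\<dagger> = \<one> X \<cdot> (\<one> X)\<^sup>\<dagger>"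
    using adj_comp[OF assms assms assms j i] adj_adj[OF assms assms i] by simp
  then show ?thesis using id_left[OF assms assms j] adj_adj[OF assms assms i] by simp
qed

lemma sum_in:
  assumes "X \<in> Obj T" "Y \<in> Obj T" "finite F" "\<And>s. s \<in> F \<Longrightarrow> p s \<in> Hom T X Y"
  shows "sum p F \<in> Hom T X Y"
  using csubspace_sum[OF hom_subspace] assms by blast

text \<open>The \<open>C\<^sup>*\<close>-identity gives the weak form \<open>\<parallel>b + p\<parallel>\<^sup>4 \<le> 2\<close> of
  \<open>\<parallel>b + p\<parallel> = max \<parallel>b\<parallel> \<parallel>p\<parallel>\<close> for orthogonal \<open>b\<close> and \<open>p\<close>; any bound below \<open>\<surd>2\<close> on
  \<open>\<parallel>b + p\<parallel>\<close> would do.\<close>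

lemma norm_add_projection:
  assumes X: "X \<in> Obj T" and b: "b \<in> Hom T X X" and p: "p \<in> Hom T X X"
    and pp: "p\<^sup>\<dagger> = p" "p \<cdot> p = p" and bp: "b \<cdot> p = 0" "p \<cdot> b = 0" and n: "norm b = 1"
  shows "norm (b + p) \<le> sqrt (sqrt 2)"
proof -
  note [simp] = X comp_add_left[OF X X X] comp_add_right[OF X X X] comp_assoc[OF X X X X]
    comp_in[OF X X X] add_in[OF X X] adj_in[OF X X] adj_add[OF X X] comp_zero_right[OF X X X]
    comp_zero_left[OF X X X] adj_zero[OF X X] adj_adj[OF X X] adj_comp[OF X X X]
  let ?a = "b\<^sup>\<dagger> \<cdot> b"
  have bp': "b\<^sup>\<dagger> \<cdot> p = 0"
    using adj_comp[OF X X X b p] bp pp by simp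
  have bp'': "p \<cdot> b\<^sup>\<dagger> = 0"
    using adj_comp[OF X X X p b] bp pp by simp
  have assoc: "p \<cdot> b\<^sup>\<dagger> \<cdot> b = 0"
    using comp_assoc[OF X X X X b _ p, of "b\<^sup>\<dagger>"] bp'' b by simp
  have np: "norm p \<le> 1"
  proof -
    have "(norm p)\<^sup>2 = norm p" using cstar_identity[OF X X p] pp by simp
    then show ?thesis by (auto simp: power2_eq_square)
  qed
  have na: "norm ?a = 1" using cstar_identity[OF X X b] n by simp
  have 1: "(b + p)\<^sup>\<dagger> \<cdot> (b + p) = ?a + p"
    using b p bp bp' pp by simp
  \<comment> \<open>A second use of the \<open>C*\<close>-identity, now on the self-adjoint
    \<open>?a + p\<close>. Applying the triangle inequality after the first use would give only the
    bound \<open>sqrt 2\<close>, just too weak for a contradiction; each further use takes one more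
    square root of 2.\<close>
  have "(?a + p)\<^sup>\<dagger> \<cdot> (?a + p) = ?a \<cdot> ?a + p"
    using b p bp bp' pp assoc by simp
  moreover have "?a + p \<in> Hom T X X" using b p by simp
  ultimately have "(norm (?a + p))\<^sup>2 = norm (?a \<cdot> ?a + p)"
    using cstar_identity[OF X X] by metis
  also have "\<dots> \<le> norm ?a * norm ?a + norm p"
    using norm_triangle_ineq[of "?a \<cdot> ?a" p] norm_comp[OF X X X, of ?a ?a] b by simp
  also have "\<dots> \<le> 2" using na np by simp
  finally have "norm (?a + p) \<le> sqrt 2" by (simp add: real_le_rsqrt)
  moreover have "(norm (b + p))\<^sup>2 = norm (?a + p)"
    using cstar_identity[OF X X add_in[OF X X b p]] 1 by metis
  ultimately show ?thesis by (simp add: real_le_rsqrt)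
qed

text \<open>This rests on \<open>(1 + b)\<^sup>2 - (1 - b)\<^sup>2 = 4b\<close>.\<close>

lemma norm_small_if_norm_id_add:
  assumes X: "X \<in> Obj T" and b: "b \<in> Hom T X X"
    and n: "norm (\<one> X + b) \<le> sqrt (sqrt 2)" "norm (\<one> X + - b) \<le> sqrt (sqrt 2)"
  shows "norm b < 1"
proof -
  note [simp] = X comp_add_left[OF X X X] comp_add_right[OF X X X]
    comp_in[OF X X X] add_in[OF X X] uminus_in[OF X X] id_in id_left[OF X X] id_right[OF X X]
    comp_uminus_left[OF X X X] comp_uminus_right[OF X X X]
  have sq: "norm (c \<cdot> c) \<le> sqrt 2" if "c \<in> Hom T X X" "norm c \<le> sqrt (sqrt 2)" for c
  proof -
    have "norm (c \<cdot> c) \<le> norm c * norm c" using norm_comp[OF X X X] that by blast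
    also have "\<dots> \<le> sqrt (sqrt 2) * sqrt (sqrt 2)" using that by (intro mult_mono) auto
    finally show ?thesis by simp
  qed
  have square: "(\<one> X + c) \<cdot> (\<one> X + c) = \<one> X + c + c + c \<cdot> c" if "c \<in> Hom T X X" for c
    using that by (simp add: add.assoc)
  have "(\<one> X + b) \<cdot> (\<one> X + b) - (\<one> X + - b) \<cdot> (\<one> X + - b) = 4 *\<^sub>R b"
    unfolding square[OF b] square[OF uminus_in[OF X X b]] using b
    by (simp add: scaleR_left_distrib[of 2 2 b, simplified] scaleR_2)
  then have "4 * norm b = norm ((\<one> X + b) \<cdot> (\<one> X + b) - (\<one> X + - b) \<cdot> (\<one> X + - b))" by simp
  also have "\<dots> \<le> sqrt 2 + sqrt 2"
    by (rule order_trans[OF norm_triangle_ineq4 add_mono])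
      (intro sq n add_in uminus_in id_in X b)+
  finally show ?thesis using sqrt2_less_2 by linarith
qed

end

context wstar_category
begin

text \<open>If \<open>b\<close> is a multiple of \<open>a\<close> of norm \<open>1\<close>, then \<open>norm_add_projection\<close> bounds \<open>\<plusminus>b\<close> plus any finite sum
  of the \<open>p s\<close>, and the bound passes to the weak limit \<open>1 \<plusminus> b\<close>. This needs only a predual; no
  continuity of the composition is available.\<close>

lemma orthogonal_to_resolution_zero:
  assumes X: "X \<in> Obj T" and P: "\<And>\<phi>. normal_functional (Hom T X X) \<phi> \<Longrightarrow> ((\<lambda>s. \<phi> (p s)) has_sum \<phi> (\<one> X)) S"
    and p: "\<And>s. s \<in> S \<Longrightarrow> p s \<in> Hom T X X" "\<And>s. s \<in> S \<Longrightarrow> (p s)\<^sup>\<dagger> = p s"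
      "\<And>s t. s \<in> S \<Longrightarrow> t \<in> S \<Longrightarrow> p s \<cdot> p t = (if s = t then p s else 0)"
    and a: "a \<in> Hom T X X" "\<And>s. s \<in> S \<Longrightarrow> a \<cdot> p s = 0" "\<And>s. s \<in> S \<Longrightarrow> p s \<cdot> a = 0"
  shows "a = 0"
proof (rule ccontr)
  assume "a \<noteq> 0"
  define b where "b = complex_of_real (1 / norm a) *\<^sub>C a"
  note E = hom_subspace[OF X X]
  obtain Q where Q: "predual (Hom T X X) Q" using hom_predual[OF X X] by blast
  have b: "b \<in> Hom T X X" "norm b = 1" "\<And>s. s \<in> S \<Longrightarrow> b \<cdot> p s = 0" "\<And>s. s \<in> S \<Longrightarrow> p s \<cdot> b = 0"
    using \<open>a \<noteq> 0\<close> a p scale_in[OF X X] comp_scale_left[OF X X X] comp_scale_right[OF X X X]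
      norm_scaleC[of _ a] norm_scaleC[of _ "0::'a"]
    by (auto simp: b_def norm_divide)
  have sum_left: "c \<cdot> sum p F = (\<Sum>s\<in>F. c \<cdot> p s)" and sum_right: "sum p F \<cdot> c = (\<Sum>s\<in>F. p s \<cdot> c)"
    and sum_adj: "(sum p F)\<^sup>\<dagger> = sum p F"
    if "finite F" "F \<subseteq> S" "c \<in> Hom T X X" for c F
    using that p(1,2) by (induction F rule: finite_induct)
      (simp_all add: comp_zero_left[OF X X X] comp_zero_right[OF X X X] adj_zero[OF X X] adj_add[OF X X]
        comp_add_left[OF X X X] comp_add_right[OF X X X] sum_in[OF X X] subset_iff)
  \<comment> \<open>Stated for arbitrary \<open>d\<close>, as it is needed for both \<open>b\<close>
    and \<open>- b\<close>.\<close>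
  have key: "norm (\<one> X + d) \<le> sqrt (sqrt 2)"
    if d: "d \<in> Hom T X X" "norm d = 1" "\<And>s. s \<in> S \<Longrightarrow> d \<cdot> p s = 0" "\<And>s. s \<in> S \<Longrightarrow> p s \<cdot> d = 0" for d
  proof (rule predual_norm_le[OF Q _ _ E])
    show "\<one> X + d \<in> Hom T X X" using add_in[OF X X id_in[OF X] d(1)] .
    fix \<phi> assume \<phi>: "\<phi> \<in> Q" "dual_norm (Hom T X X) \<phi> \<le> 1"
    then have b\<phi>: "bounded_functional (Hom T X X) \<phi>" using Q unfolding predual_def by blast
    have "((\<lambda>s. \<phi> (p s)) has_sum \<phi> (\<one> X)) S" using P Q \<phi> unfolding normal_functional_def by blast
    then have "(sum (\<lambda>s. \<phi> (p s)) \<longlongrightarrow> \<phi> (\<one> X)) (finite_subsets_at_top S)" unfolding has_sum_def .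
    then have "((\<lambda>F. (\<Sum>s\<in>F. \<phi> (p s)) + \<phi> d) \<longlongrightarrow> \<phi> (\<one> X) + \<phi> d) (finite_subsets_at_top S)"
      by (intro tendsto_intros)
    moreover have "\<forall>\<^sub>F F in finite_subsets_at_top S. cmod ((\<Sum>s\<in>F. \<phi> (p s)) + \<phi> d) \<le> sqrt (sqrt 2)"
    proof (rule eventually_finite_subsets_at_top_weakI)
      fix F assume F: "finite F" "F \<subseteq> S"
      have s: "sum p F \<in> Hom T X X" using F p by (intro sum_in X) auto
      \<comment> \<open>Orthogonality makes each finite partial sum a projection again, so the
        estimate for one projection applies to it.\<close>
      have "sum p F \<cdot> sum p F = (\<Sum>s\<in>F. \<Sum>t\<in>F. p s \<cdot> p t)"
        using sum_right[OF F s] sum_left[OF F] F p(1) by (simp add: subset_iff)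
      also have "\<dots> = (\<Sum>s\<in>F. \<Sum>t\<in>F. if s = t then p s else 0)"
        using F p(3) by (intro sum.cong refl) (auto simp: subset_iff)
      also have "\<dots> = sum p F" using F by simp
      finally have "norm (d + sum p F) \<le> sqrt (sqrt 2)"
        using sum_left[OF F d(1)] sum_right[OF F d(1)] sum_adj[OF F d(1)] d F s
        by (intro norm_add_projection[OF X]) (auto intro!: sum.neutral simp: subset_iff)
      then have "cmod (\<phi> (d + sum p F)) \<le> sqrt (sqrt 2)"
        by (intro bounded_functional_le[OF E b\<phi> \<phi>(2)] add_in X d s) auto
      moreover have "\<phi> (d + sum p F) = (\<Sum>s\<in>F. \<phi> (p s)) + \<phi> d"
        using b\<phi> d(1) s bounded_functional_sum[OF E b\<phi> F(1)] p(1) F(2)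
        by (simp add: bounded_functional_def subset_iff)
      ultimately show "cmod ((\<Sum>s\<in>F. \<phi> (p s)) + \<phi> d) \<le> sqrt (sqrt 2)" by simp
    qed
    ultimately have "cmod (\<phi> (\<one> X) + \<phi> d) \<le> sqrt (sqrt 2)"
      by (intro Lim_norm_ubound[OF finite_subsets_at_top_neq_bot])
    then show "cmod (\<phi> (\<one> X + d)) \<le> sqrt (sqrt 2)"
      using b\<phi> id_in[OF X] d(1) by (simp add: bounded_functional_def)
  qed
  have "norm b < 1"
    using b p by (intro norm_small_if_norm_id_add[OF X] key)
      (auto simp: uminus_in[OF X X] comp_uminus_left[OF X X X] comp_uminus_right[OF X X X])
  then show False using b(2) by simp
qed

text \<open>Unitarity supplies the missing side: the adjoint of \<open>u \<cdot> p s = p s\<close>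
  shows that \<open>p s\<close> absorbs the adjoint of \<open>u\<close> on the right, hence also
  \<open>u\<close>. So \<open>u - 1\<close> is annihilated by the resolution from both
  sides.\<close>

lemma unitary_fixing_resolution:
  assumes X: "X \<in> Obj T" and P: "\<And>\<phi>. normal_functional (Hom T X X) \<phi> \<Longrightarrow> ((\<lambda>s. \<phi> (p s)) has_sum \<phi> (\<one> X)) S"
    and p: "\<And>s. s \<in> S \<Longrightarrow> p s \<in> Hom T X X" "\<And>s. s \<in> S \<Longrightarrow> (p s)\<^sup>\<dagger> = p s"
      "\<And>s t. s \<in> S \<Longrightarrow> t \<in> S \<Longrightarrow> p s \<cdot> p t = (if s = t then p s else 0)"
    and u: "unitary T X X u" "\<And>s. s \<in> S \<Longrightarrow> u \<cdot> p s = p s"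
  shows "u = \<one> X"
proof -
  have u': "u \<in> Hom T X X" "u\<^sup>\<dagger> \<in> Hom T X X" "u\<^sup>\<dagger> \<cdot> u = \<one> X"
    using u(1) adj_in[OF X X] unfolding unitary_def by blast+
  have pu: "p s \<cdot> u = p s" if s: "s \<in> S" for s
  proof -
    have "p s = p s \<cdot> u\<^sup>\<dagger>" using adj_comp[OF X X X p(1)[OF s] u'(1)] u(2)[OF s] p(2)[OF s] by simp
    then have "p s \<cdot> u = (p s \<cdot> u\<^sup>\<dagger>) \<cdot> u" by simp
    then show ?thesis
      using comp_assoc[OF X X X X u'(1,2) p(1)[OF s]] u'(3) id_right[OF X X p(1)[OF s]] by simp
  qed
  note i = id_in[OF X]
  have "u + - \<one> X = 0"
  proof (rule orthogonal_to_resolution_zero[OF X P p])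
    show "u + - \<one> X \<in> Hom T X X" using add_in[OF X X u'(1) uminus_in[OF X X i]] .
    fix s assume s: "s \<in> S"
    note s' = p(1)[OF s]
    show "(u + - \<one> X) \<cdot> p s = 0"
      using comp_add_left[OF X X X s' u'(1) uminus_in[OF X X i]] comp_uminus_left[OF X X X s' i]
        id_left[OF X X s'] u(2)[OF s] by simp
    show "p s \<cdot> (u + - \<one> X) = 0"
      using comp_add_right[OF X X X u'(1) uminus_in[OF X X i] s'] comp_uminus_right[OF X X X i s']
        id_right[OF X X s'] pu[OF s] by simp
  qed
  then show ?thesis by simp
qed

end

section \<open>Resolutions of the identity under tensoring\<close>

context tensor_wstar_category
begin

text \<open>As \<open>0\<close> lies in every arrow space, it may be read as a multiple of
  \<open>\<one> \<U>\<close>.\<close>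

lemma tens_zero_left:
  assumes "X \<in> Obj T" "Y \<in> Obj T" "g \<in> Hom T X Y" shows "0 \<boxtimes> g = 0"
  using tens_scale_left[OF unit_ob unit_ob assms(1,2) id_in[OF unit_ob] assms(3), of 0]
  by (simp add: scaleC_zero)

lemma tens_zero_right:
  assumes "X \<in> Obj T" "Y \<in> Obj T" "f \<in> Hom T X Y" shows "f \<boxtimes> 0 = 0"
  using tens_scale_right[OF assms(1,2) unit_ob unit_ob assms(3) id_in[OF unit_ob], of 0]
  by (simp add: scaleC_zero)

lemma comp_tens_id:
  assumes "A \<in> Obj T" "B \<in> Obj T" "C \<in> Obj T" "V \<in> Obj T" "f \<in> Hom T A B" "g \<in> Hom T B C"
  shows "(g \<cdot> f) \<boxtimes> \<one> V = (g \<boxtimes> \<one> V) \<cdot> (f \<boxtimes> \<one> V)"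
    and "\<one> V \<boxtimes> (g \<cdot> f) = (\<one> V \<boxtimes> g) \<cdot> (\<one> V \<boxtimes> f)"
proof -
  note V = id_in[OF assms(4)]
  have "\<one> V \<cdot> \<one> V = \<one> V" by (rule id_left[OF assms(4,4) V])
  then show "(g \<cdot> f) \<boxtimes> \<one> V = (g \<boxtimes> \<one> V) \<cdot> (f \<boxtimes> \<one> V)"
    and "\<one> V \<boxtimes> (g \<cdot> f) = (\<one> V \<boxtimes> g) \<cdot> (\<one> V \<boxtimes> f)"
    using tens_comp[OF assms(1-3) assms(4,4,4) assms(5,6) V V]
      tens_comp[OF assms(4,4,4) assms(1-3) V V assms(5,6)] by argo+
qed

end

context hilbert_functor
begin

text \<open>\<open>D\<close> and \<open>\<tau>\<close> stand for tensoring with a fixed object, on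
  either side, so that \<open>\<eta>\<close> and \<open>\<xi>\<close> share one proof. An arrow
  fixing all \<open>\<tau> s\<close> also fixes the images under \<open>\<tau>\<close> of the rank
  one projections built from \<open>s\<close>, and normality of \<open>\<tau>\<close> makes these a
  resolution of the identity.\<close>

lemma unitary_fixing_units:
  assumes W: "W \<in> Obj T" and D: "\<And>A. A \<in> Obj T \<Longrightarrow> D A \<in> Obj T"
    and \<tau>_in: "\<And>A B f. \<lbrakk>A \<in> Obj T; B \<in> Obj T; f \<in> Hom T A B\<rbrakk> \<Longrightarrow> \<tau> f \<in> Hom T (D A) (D B)"
    and \<tau>_id: "\<And>A. A \<in> Obj T \<Longrightarrow> \<tau> (\<one> A) = \<one> (D A)"
    and \<tau>_comp: "\<And>A B C f g. \<lbrakk>A \<in> Obj T; B \<in> Obj T; C \<in> Obj T; f \<in> Hom T A B; g \<in> Hom T B C\<rbrakk>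
      \<Longrightarrow> \<tau> (g \<cdot> f) = \<tau> g \<cdot> \<tau> f"
    and \<tau>_adj: "\<And>A B f. \<lbrakk>A \<in> Obj T; B \<in> Obj T; f \<in> Hom T A B\<rbrakk> \<Longrightarrow> \<tau> (f\<^sup>\<dagger>) = (\<tau> f)\<^sup>\<dagger>"
    and \<tau>_zero: "\<tau> 0 = 0"
    and \<tau>_normal: "\<And>A B. \<lbrakk>A \<in> Obj T; B \<in> Obj T\<rbrakk> \<Longrightarrow> normal_map (Hom T A B) (Hom T (D A) (D B)) \<tau>"
    and u: "unitary T (D (on_ob \<iota> W)) (D (on_ob \<iota> W)) u"
    and u_units: "\<And>s. s \<in> Hom T \<U> (on_ob \<iota> W) \<Longrightarrow> u \<cdot> \<tau> s = \<tau> s"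
  shows "u = \<one> (D (on_ob \<iota> W))"
proof -
  let ?H = "on_ob \<iota> W"
  interpret C: hilbert_category "hilbert_copies T \<iota>" by (rule hilbert_copies_hilbert)
  have H: "?H \<in> Obj T" using W by (rule F_ob)
  have U: "on_ob \<iota> \<U> = \<U>" by (rule F_unit)
  \<comment> \<open>In \<open>hilbert_copies\<close> the arrow spaces at \<open>W\<close> are those
    of \<open>T\<close> at \<open>on_ob \<iota> W\<close>, so the basis consists of arrows of
    \<open>T\<close>.\<close>
  have "direct_sum_of_units (hilbert_copies T \<iota>) W"
    using C.units_generate[of W] W by (simp add: copies_simps)
  then obtain B where B: "B \<subseteq> Hom T \<U> ?H"
    and orth: "\<forall>s\<in>B. \<forall>t\<in>B. s\<^sup>\<dagger> \<cdot> t = (if s = t then \<one> \<U> else 0)"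
    and total: "\<forall>\<phi>. normal_functional (Hom T ?H ?H) \<phi> \<longrightarrow> ((\<lambda>s. \<phi> (s \<cdot> s\<^sup>\<dagger>)) has_sum \<phi> (\<one> ?H)) B"
    unfolding direct_sum_of_units_def copies_simps U by (elim exE conjE)
  note ss = unit_ob H
  have B': "s \<in> Hom T \<U> ?H" "s\<^sup>\<dagger> \<in> Hom T ?H \<U>" if "s \<in> B" for s
    using that B adj_in[OF ss] by auto
  have sst: "s \<cdot> s\<^sup>\<dagger> \<in> Hom T ?H ?H" if "s \<in> B" for s
    using B'[OF that] comp_in[OF H unit_ob H] by blast
  have \<tau>s: "\<tau> (s \<cdot> s\<^sup>\<dagger>) = \<tau> s \<cdot> \<tau> (s\<^sup>\<dagger>)" if "s \<in> B" for s
    using \<tau>_comp[OF H unit_ob H] B' that by blast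
  show ?thesis
  proof (rule unitary_fixing_resolution[OF D[OF H], where S = B and p = "\<lambda>s. \<tau> (s \<cdot> s\<^sup>\<dagger>)"])
    fix \<phi> assume "normal_functional (Hom T (D ?H) (D ?H)) \<phi>"
    \<comment> \<open>Pulling back along \<open>\<tau>\<close> reduces the claim to the basis of
      \<open>?H\<close>. The default \<open>0\<close> reflects the convention that functionals
      vanish off their space.\<close>
    then have "normal_functional (Hom T ?H ?H) (\<lambda>f. if f \<in> Hom T ?H ?H then \<phi> (\<tau> f) else 0)"
      using \<tau>_normal[OF H H] unfolding normal_map_def by blast
    from total[rule_format, OF this]
    have "((\<lambda>s. if s \<cdot> s\<^sup>\<dagger> \<in> Hom T ?H ?H then \<phi> (\<tau> (s \<cdot> s\<^sup>\<dagger>)) else 0) has_sum \<phi> (\<one> (D ?H))) B"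
      by (simp add: id_in[OF H] \<tau>_id[OF H])
    then show "((\<lambda>s. \<phi> (\<tau> (s \<cdot> s\<^sup>\<dagger>))) has_sum \<phi> (\<one> (D ?H))) B"
      using sst by (simp cong: has_sum_cong)
  next
    fix s assume s: "s \<in> B"
    show "\<tau> (s \<cdot> s\<^sup>\<dagger>) \<in> Hom T (D ?H) (D ?H)" using \<tau>_in[OF H H sst[OF s]] .
    show "(\<tau> (s \<cdot> s\<^sup>\<dagger>))\<^sup>\<dagger> = \<tau> (s \<cdot> s\<^sup>\<dagger>)"
      using \<tau>_adj[OF H H sst[OF s]] adj_comp[OF H unit_ob H B'(2)[OF s] B'(1)[OF s]]
        adj_adj[OF ss B'(1)[OF s]] by simp
    show "u \<cdot> \<tau> (s \<cdot> s\<^sup>\<dagger>) = \<tau> (s \<cdot> s\<^sup>\<dagger>)"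
      using u_units[OF B'(1)[OF s]] \<tau>s[OF s] u comp_assoc[OF D[OF H] D[OF unit_ob] D[OF H] D[OF H]
        \<tau>_in[OF H unit_ob B'(2)[OF s]] \<tau>_in[OF ss B'(1)[OF s]], of u]
      by (simp add: unitary_def)
  next
    fix s t assume s: "s \<in> B" and t: "t \<in> B"
    have "(s \<cdot> s\<^sup>\<dagger>) \<cdot> (t \<cdot> t\<^sup>\<dagger>) = s \<cdot> (s\<^sup>\<dagger> \<cdot> t) \<cdot> t\<^sup>\<dagger>"
      using comp_assoc[OF H H unit_ob H sst[OF t] B'(2)[OF s] B'(1)[OF s]]
        comp_assoc[OF H unit_ob H unit_ob B'(2)[OF t] B'(1)[OF t] B'(2)[OF s]] by simp
    also have "\<dots> = (if s = t then s \<cdot> s\<^sup>\<dagger> else 0)"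
      using orth[rule_format, OF s t] B'[OF s] B'[OF t] id_left[OF H unit_ob] comp_zero_left[OF H unit_ob unit_ob]
        comp_zero_right[OF H unit_ob H] by simp
    finally show "\<tau> (s \<cdot> s\<^sup>\<dagger>) \<cdot> \<tau> (t \<cdot> t\<^sup>\<dagger>) = (if s = t then \<tau> (s \<cdot> s\<^sup>\<dagger>) else 0)"
      using \<tau>_comp[OF H H H sst[OF t] sst[OF s]] \<tau>_zero
      by (cases "s = t") simp_all
  qed (rule u)
qed

lemma faithfulD:
  assumes "X \<in> Obj T" "Y \<in> Obj T" "f \<in> Hom T X Y" "g \<in> Hom T X Y" "on_ar \<iota> f = on_ar \<iota> g"
  shows "f = g"
  using iota_faithful assms unfolding faithful_def inj_on_def by blast

lemma unitary_fixing_units_right: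
  assumes W: "W \<in> Obj T" and V: "V \<in> Obj T"
    and u: "unitary T (on_ob \<iota> W \<otimes> V) (on_ob \<iota> W \<otimes> V) u"
    and u_units: "\<And>s. s \<in> Hom T \<U> (on_ob \<iota> W) \<Longrightarrow> u \<cdot> (s \<boxtimes> \<one> V) = s \<boxtimes> \<one> V"
  shows "u = \<one> (on_ob \<iota> W \<otimes> V)"
proof (rule unitary_fixing_units[OF W, of "\<lambda>X. X \<otimes> V" "\<lambda>f. f \<boxtimes> \<one> V"])
  show "(g \<cdot> f) \<boxtimes> \<one> V = (g \<boxtimes> \<one> V) \<cdot> (f \<boxtimes> \<one> V)"
    if "A \<in> Obj T" "B \<in> Obj T" "C \<in> Obj T" "f \<in> Hom T A B" "g \<in> Hom T B C" for A B C f g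
    using comp_tens_id(1)[OF that(1-3) V that(4,5)] .
qed (simp_all add: u u_units V tens_ob tens_in[OF _ _ V V] id_in tens_id tens_adj[OF _ _ V V] id_adj
    tens_zero_left[OF V V] tens_normal_left)

lemma unitary_fixing_units_left:
  assumes W: "W \<in> Obj T" and V: "V \<in> Obj T"
    and u: "unitary T (V \<otimes> on_ob \<iota> W) (V \<otimes> on_ob \<iota> W) u"
    and u_units: "\<And>s. s \<in> Hom T \<U> (on_ob \<iota> W) \<Longrightarrow> u \<cdot> (\<one> V \<boxtimes> s) = \<one> V \<boxtimes> s"
  shows "u = \<one> (V \<otimes> on_ob \<iota> W)"
proof (rule unitary_fixing_units[OF W, of "\<lambda>X. V \<otimes> X" "\<lambda>f. \<one> V \<boxtimes> f"])
  show "\<one> V \<boxtimes> (g \<cdot> f) = (\<one> V \<boxtimes> g) \<cdot> (\<one> V \<boxtimes> f)"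
    if "A \<in> Obj T" "B \<in> Obj T" "C \<in> Obj T" "f \<in> Hom T A B" "g \<in> Hom T B C" for A B C f g
    using comp_tens_id(2)[OF that(1-3) V that(4,5)] .
qed (simp_all add: u u_units V tens_ob tens_in[OF V V] id_in tens_id tens_adj[OF V V] id_adj
    tens_zero_right[OF V V] tens_normal_right)

end

section \<open>Typed arrows\<close>

text \<open>Pairing an arrow with its source and target makes the side conditions of associativity and
  of the interchange law computable, so that the simplifier can discharge them; in \<open>T\<close> itself an
  element may belong to several arrow spaces.\<close>

type_synonym ('o, 'a) typed = "'o \<times> 'a \<times> 'o"

definition src :: "('o, 'a) typed \<Rightarrow> 'o" where "src t = fst t"
definition arr :: "('o, 'a) typed \<Rightarrow> 'a" where "arr t = fst (snd t)"
definition tgt :: "('o, 'a) typed \<Rightarrow> 'o" where "tgt t = snd (snd t)"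

lemma src_arr_tgt [simp]: "src (X, f, Y) = X" "arr (X, f, Y) = f" "tgt (X, f, Y) = Y"
  by (simp_all add: src_def arr_def tgt_def)

lemma typed_eqI: "src s = src t \<Longrightarrow> arr s = arr t \<Longrightarrow> tgt s = tgt t \<Longrightarrow> s = t"
  by (cases s, cases t) simp

context hilbert_functor
begin

abbreviation H :: "'o \<Rightarrow> 'o" where "H X \<equiv> on_ob \<iota> X"

definition typed :: "('o, 'a) typed \<Rightarrow> bool" where
  "typed t \<longleftrightarrow> src t \<in> Obj T \<and> tgt t \<in> Obj T \<and> arr t \<in> Hom T (src t) (tgt t)"

definition seq :: "('o, 'a) typed \<Rightarrow> ('o, 'a) typed \<Rightarrow> ('o, 'a) typed" (infixr "\<odot>" 70) where
  "t \<odot> s = (src s, arr t \<cdot> arr s, tgt t)"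

definition par :: "('o, 'a) typed \<Rightarrow> ('o, 'a) typed \<Rightarrow> ('o, 'a) typed" (infixr "\<star>" 75) where
  "s \<star> t = (src s \<otimes> src t, arr s \<boxtimes> arr t, tgt s \<otimes> tgt t)"

definition idn :: "'o \<Rightarrow> ('o, 'a) typed" where "idn X = (X, \<one> X, X)"

definition flip :: "'o \<Rightarrow> 'o \<Rightarrow> ('o, 'a) typed" where "flip X Y = (X \<otimes> Y, \<theta> X Y, Y \<otimes> X)"

definition adj :: "('o, 'a) typed \<Rightarrow> ('o, 'a) typed" where "adj t = (tgt t, (arr t)\<^sup>\<dagger>, src t)"

definition iot :: "('o, 'a) typed \<Rightarrow> ('o, 'a) typed" where
  "iot t = (H (src t), on_ar \<iota> (arr t), H (tgt t))"

lemma typed_components [simp]: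
  "src (t \<odot> s) = src s" "arr (t \<odot> s) = arr t \<cdot> arr s" "tgt (t \<odot> s) = tgt t"
  "src (s \<star> t) = src s \<otimes> src t" "arr (s \<star> t) = arr s \<boxtimes> arr t" "tgt (s \<star> t) = tgt s \<otimes> tgt t"
  "src (idn X) = X" "arr (idn X) = \<one> X" "tgt (idn X) = X"
  "src (flip X Y) = X \<otimes> Y" "arr (flip X Y) = \<theta> X Y" "tgt (flip X Y) = Y \<otimes> X"
  "src (adj t) = tgt t" "arr (adj t) = (arr t)\<^sup>\<dagger>" "tgt (adj t) = src t"
  "src (iot t) = H (src t)" "arr (iot t) = on_ar \<iota> (arr t)" "tgt (iot t) = H (tgt t)"
  by (simp_all add: seq_def par_def idn_def flip_def adj_def iot_def)

lemma typedD: "typed t \<Longrightarrow> src t \<in> Obj T" "typed t \<Longrightarrow> tgt t \<in> Obj T"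
  "typed t \<Longrightarrow> X = src t \<Longrightarrow> Y = tgt t \<Longrightarrow> arr t \<in> Hom T X Y"
  by (simp_all add: typed_def)

lemmas [simp] = unit_ob tens_ob tens_ob_assoc unit_tens_ob tens_ob_unit F_ob F_tens_ob F_unit iota_iota

lemma typed_idn [simp]: "X \<in> Obj T \<Longrightarrow> typed (idn X)"
  by (simp add: typed_def id_in)

lemma typed_seq [simp]: "typed s \<Longrightarrow> typed t \<Longrightarrow> tgt s = src t \<Longrightarrow> typed (t \<odot> s)"
  using comp_in[of "src s" "src t" "tgt t" "arr s" "arr t"] by (auto simp: typed_def)

lemma typed_par [simp]: "typed s \<Longrightarrow> typed t \<Longrightarrow> typed (s \<star> t)"
  using tens_in[of "src s" "tgt s" "src t" "tgt t" "arr s" "arr t"] by (simp add: typed_def)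

lemma typed_adj [simp]: "typed t \<Longrightarrow> typed (adj t)"
  using adj_in[of "src t" "tgt t" "arr t"] by (simp add: typed_def)

lemma typed_iot [simp]: "typed t \<Longrightarrow> typed (iot t)"
  using F_in[of "src t" "tgt t" "arr t"] by (simp add: typed_def)

text \<open>Lying in the image of \<open>\<iota>\<close> is expressed by the equation
  \<open>H X = X\<close>, which the simplifier can decide from idempotence and the tensor formula
  for \<open>\<iota>\<close>.\<close>

lemma typed_flip [simp]:
  assumes "X \<in> Obj T" "Y \<in> Obj T" "H X = X \<or> H Y = Y"
  shows "typed (flip X Y)"
  using assms theta_left[of X Y] theta_right[of X Y] by (auto simp: typed_def)

declare typedD [simp]

lemma seq_assoc [simp]:
  "typed s \<Longrightarrow> typed t \<Longrightarrow> typed u \<Longrightarrow> tgt s = src t \<Longrightarrow> tgt t = src u \<Longrightarrow> (u \<odot> t) \<odot> s = u \<odot> t \<odot> s"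
  using comp_assoc[of "src s" "src t" "src u" "tgt u" "arr s" "arr t" "arr u"]
  by (intro typed_eqI) auto

lemma par_assoc [simp]: "typed s \<Longrightarrow> typed t \<Longrightarrow> typed u \<Longrightarrow> (s \<star> t) \<star> u = s \<star> t \<star> u"
  using tens_assoc[of "src s" "tgt s" "src t" "tgt t" "src u" "tgt u" "arr s" "arr t" "arr u"]
  by (intro typed_eqI) auto

lemma seq_idn [simp]:
  "typed s \<Longrightarrow> X = tgt s \<Longrightarrow> idn X \<odot> s = s" "typed s \<Longrightarrow> X = src s \<Longrightarrow> s \<odot> idn X = s"
  using id_left[of "src s" "tgt s" "arr s"] id_right[of "src s" "tgt s" "arr s"]
  by (auto intro!: typed_eqI)

lemma par_unit [simp]: "typed s \<Longrightarrow> idn \<U> \<star> s = s" "typed s \<Longrightarrow> s \<star> idn \<U> = s"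
  using unit_tens[of "src s" "tgt s" "arr s"] tens_unit[of "src s" "tgt s" "arr s"]
  by (auto intro!: typed_eqI)

lemma par_idn [simp]: "X \<in> Obj T \<Longrightarrow> Y \<in> Obj T \<Longrightarrow> idn X \<star> idn Y = idn (X \<otimes> Y)"
  by (auto intro!: typed_eqI simp: tens_id)

text \<open>Products are nested to the right, so \<open>par_idn\<close> alone never sees two
  adjacent identities followed by a further factor.\<close>

lemma par_idn_idn [simp]:
  "X \<in> Obj T \<Longrightarrow> Y \<in> Obj T \<Longrightarrow> typed s \<Longrightarrow> idn X \<star> idn Y \<star> s = idn (X \<otimes> Y) \<star> s"
  using par_assoc[of "idn X" "idn Y" s] by simp

lemma interchange:
  assumes "typed s" "typed s'" "typed t" "typed t'" "tgt s = src t" "tgt s' = src t'"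
  shows "(t \<star> t') \<odot> (s \<star> s') = (t \<odot> s) \<star> (t' \<odot> s')"
  using assms tens_comp[of "src s" "src t" "tgt t" "src s'" "src t'" "tgt t'" "arr s" "arr t" "arr s'" "arr t'"]
  by (intro typed_eqI) auto

lemma seq_par_idn:
  assumes "typed s" "typed t" "tgt s = src t" "X \<in> Obj T"
  shows "(t \<odot> s) \<star> idn X = (t \<star> idn X) \<odot> (s \<star> idn X)" "idn X \<star> (t \<odot> s) = (idn X \<star> t) \<odot> (idn X \<star> s)"
  using assms by (simp_all add: interchange)

lemma adj_simps [simp]:
  "typed s \<Longrightarrow> adj (adj s) = s"
  "typed s \<Longrightarrow> typed t \<Longrightarrow> tgt s = src t \<Longrightarrow> adj (t \<odot> s) = adj s \<odot> adj t"
  "typed s \<Longrightarrow> typed t \<Longrightarrow> adj (s \<star> t) = adj s \<star> adj t"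
  "X \<in> Obj T \<Longrightarrow> adj (idn X) = idn X"
  using adj_adj[of "src s" "tgt s" "arr s"] adj_comp[of "src s" "src t" "tgt t" "arr s" "arr t"]
    tens_adj[of "src s" "tgt s" "src t" "tgt t" "arr s" "arr t"]
  by (auto intro!: typed_eqI simp: id_adj)

lemma iot_simps [simp]:
  "typed s \<Longrightarrow> typed t \<Longrightarrow> tgt s = src t \<Longrightarrow> iot (t \<odot> s) = iot t \<odot> iot s"
  "typed s \<Longrightarrow> typed t \<Longrightarrow> iot (s \<star> t) = iot s \<star> iot t"
  "X \<in> Obj T \<Longrightarrow> iot (idn X) = idn (H X)"
  "typed s \<Longrightarrow> iot (iot s) = iot s"
  "typed s \<Longrightarrow> iot (adj s) = adj (iot s)"
  using F_comp[of "src s" "src t" "tgt t" "arr s" "arr t"] F_adj[of "src s" "tgt s" "arr s"]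
    F_tens[of "src s" "tgt s" "src t" "tgt t" "arr s" "arr t"]
    iota_idem[unfolded idempotent_def, THEN conjunct2, rule_format, of "src s" "tgt s" "arr s"]
  by (auto intro!: typed_eqI simp: F_id)

lemma iot_flip [simp]:
  assumes "X \<in> Obj T" "Y \<in> Obj T" "H X = X \<or> H Y = Y"
  shows "iot (flip X Y) = flip (H X) (H Y)"
  using assms theta_left[of X Y] theta_right[of X Y] by (intro typed_eqI) auto

text \<open>Faithfulness: identities between flips with only one Hilbert factor may be checked after
  \<open>\<iota>\<close>, where all factors are Hilbert spaces.\<close>

lemma iot_eqD:
  assumes "iot s = iot t" "typed s" "typed t" "src s = src t" "tgt s = tgt t"
  shows "s = t"
proof -
  have e: "on_ar \<iota> (arr s) = on_ar \<iota> (arr t)" using arg_cong[OF assms(1), of arr] by simp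
  show ?thesis
    by (rule typed_eqI[OF assms(4) faithfulD[OF typedD(1,2)[OF assms(2)] typedD(3)[OF assms(2) refl refl]
      typedD(3)[OF assms(3-5)] e] assms(5)])
qed

section \<open>Calculus of flips, with at least one Hilbert factor\<close>

lemma H_flip:
  assumes X: "X \<in> Obj T" and Y: "Y \<in> Obj T"
  shows "flip (H Y) (H X) \<odot> flip (H X) (H Y) = idn (H X \<otimes> H Y)"
    and "adj (flip (H X) (H Y)) = flip (H Y) (H X)"
    and "Z \<in> Obj T \<Longrightarrow> flip (H X \<otimes> H Y) (H Z)
      = (flip (H X) (H Z) \<star> idn (H Y)) \<odot> (idn (H X) \<star> flip (H Y) (H Z))"
proof -
  interpret C: permutation_symmetry "hilbert_copies T \<iota>" "hilbert_flip \<iota> \<theta>"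
    by (rule hilbert_copies_symmetry)
  note C = copies_simps hilbert_flip_def
  show 1: "flip (H Y) (H X) \<odot> flip (H X) (H Y) = idn (H X \<otimes> H Y)"
    using C.sym_sym[of X Y] X Y by (intro typed_eqI) (simp_all add: C)
  have 2: "flip (H X) (H Y) \<odot> adj (flip (H X) (H Y)) = idn (H Y \<otimes> H X)"
    using C.sym_unitary[of X Y] X Y by (intro typed_eqI) (simp_all add: C unitary_def)
  \<comment> \<open>The adjoint and the opposite flip are inverses of the same arrow, hence
    equal.\<close>
  have "(flip (H Y) (H X) \<odot> flip (H X) (H Y)) \<odot> adj (flip (H X) (H Y)) = flip (H Y) (H X)"
    using X Y by (simp add: 2)
  then show "adj (flip (H X) (H Y)) = flip (H Y) (H X)"
    unfolding 1 using X Y by simp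
  show "Z \<in> Obj T \<Longrightarrow> flip (H X \<otimes> H Y) (H Z)
      = (flip (H X) (H Z) \<star> idn (H Y)) \<odot> (idn (H X) \<star> flip (H Y) (H Z))"
    using C.sym_tens[of X Y Z] X Y by (intro typed_eqI) (simp_all add: C)
qed

lemma H_flip_natural:
  assumes "typed s" "typed t"
  shows "flip (H (tgt s)) (H (tgt t)) \<odot> (iot s \<star> iot t) = (iot t \<star> iot s) \<odot> flip (H (src s)) (H (src t))"
proof -
  interpret C: permutation_symmetry "hilbert_copies T \<iota>" "hilbert_flip \<iota> \<theta>"
    by (rule hilbert_copies_symmetry)
  show ?thesis
    using C.sym_natural[of "src s" "src t" "tgt s" "tgt t" "arr (iot s)" "arr (iot t)"] assms
      typedD(3)[OF typed_iot[OF assms(1)] refl refl] typedD(3)[OF typed_iot[OF assms(2)] refl refl]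
    by (intro typed_eqI) (simp_all add: copies_simps hilbert_flip_def)
qed

lemma flip_flip:
  assumes "X \<in> Obj T" "Y \<in> Obj T" "H X = X \<or> H Y = Y"
  shows "flip Y X \<odot> flip X Y = idn (X \<otimes> Y)"
  by (rule iot_eqD) (use assms H_flip(1)[of X Y] in \<open>auto simp: disj_commute\<close>)

lemma adj_flip:
  assumes "X \<in> Obj T" "Y \<in> Obj T" "H X = X \<or> H Y = Y"
  shows "adj (flip X Y) = flip Y X"
  by (rule iot_eqD) (use assms H_flip(2)[of X Y] in \<open>auto simp: disj_commute\<close>)

lemma flip_par:
  assumes "X \<in> Obj T" "Y \<in> Obj T" "Z \<in> Obj T" "H X = X" "H Y = Y"
  shows "flip (X \<otimes> Y) Z = (flip X Z \<star> idn Y) \<odot> (idn X \<star> flip Y Z)"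
  by (rule iot_eqD) (use assms H_flip(3)[of X Y Z] in auto)

lemma flip_natural:
  assumes "typed s" "typed t" "(H (src s) = src s \<and> H (tgt s) = tgt s) \<or> (H (src t) = src t \<and> H (tgt t) = tgt t)"
  shows "flip (tgt s) (tgt t) \<odot> (s \<star> t) = (t \<star> s) \<odot> flip (src s) (src t)"
  by (rule iot_eqD) (use assms H_flip_natural[of s t] in auto)

text \<open>The tensor formula at the unit makes \<open>flip \<U> X\<close> idempotent, and an
  idempotent unitary is trivial.\<close>

lemma flip_unit: "X \<in> Obj T \<Longrightarrow> flip \<U> X = idn X" "X \<in> Obj T \<Longrightarrow> flip X \<U> = idn X"
proof -
  assume X: "X \<in> Obj T"
  have u: "adj (flip \<U> X) \<odot> flip \<U> X = idn X"
    using flip_flip[of \<U> X] X by (simp add: adj_flip)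
  have "flip \<U> X \<odot> flip \<U> X = flip \<U> X"
    using flip_par[of \<U> \<U> X] X by simp
  then have "(adj (flip \<U> X) \<odot> flip \<U> X) \<odot> flip \<U> X = adj (flip \<U> X) \<odot> flip \<U> X"
    using X by simp
  then show 1: "flip \<U> X = idn X" using X by (simp add: u del: seq_assoc)
  show "flip X \<U> = idn X" using flip_flip[of X \<U>] X by (simp add: 1)
qed

text \<open>The factor \<open>B\<close> can be kept out of the way of \<open>u\<close> by moving it
  past \<open>D\<close> or past \<open>A\<close>. Moving it past both turns
  \<open>u \<star> idn B\<close> into \<open>idn B \<star> u\<close> by naturality, and that flip
  splits into the two partial ones. Left regularity uses one form, \<open>leg13\<close> the
  other.\<close>

lemma leg13_flip:
  assumes "A \<in> Obj T" "B \<in> Obj T" "D \<in> Obj T" "H A = A" "H B = B" "H D = D"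
    and "typed u" "src u = A \<otimes> D" "tgt u = A \<otimes> D"
  shows "(flip B A \<star> idn D) \<odot> (idn B \<star> u) \<odot> (flip A B \<star> idn D)
    = (idn A \<star> flip D B) \<odot> (u \<star> idn B) \<odot> (idn A \<star> flip B D)"
proof -
  let ?F = "(flip A B \<star> idn D) \<odot> (idn A \<star> flip D B)"
  have F: "flip (A \<otimes> D) B = ?F" using flip_par[of A D B] assms by simp
  have 1: "?F \<odot> (idn A \<star> flip B D) = flip A B \<star> idn D"
    using assms by (simp add: seq_par_idn(2)[symmetric] flip_flip)
  \<comment> \<open>Composites are nested to the right, so the cancellation is needed in front of a
    tail \<open>s\<close>.\<close>
  have 2: "(flip B A \<star> idn D) \<odot> (flip A B \<star> idn D) \<odot> s = s"
    if "typed s" "tgt s = A \<otimes> B \<otimes> D" for s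
    using assms that by (simp add: seq_par_idn(1)[symmetric] flip_flip seq_assoc[symmetric] del: seq_assoc)
  have "?F \<odot> (u \<star> idn B) = (idn B \<star> u) \<odot> ?F"
    using flip_natural[of u "idn B"] assms by (simp add: F)
  then have "(?F \<odot> (u \<star> idn B)) \<odot> (idn A \<star> flip B D) = ((idn B \<star> u) \<odot> ?F) \<odot> (idn A \<star> flip B D)"
    by simp
  also have "\<dots> = (idn B \<star> u) \<odot> (?F \<odot> (idn A \<star> flip B D))" using assms by simp
  finally have "(flip A B \<star> idn D) \<odot> ((idn A \<star> flip D B) \<odot> (u \<star> idn B) \<odot> (idn A \<star> flip B D))
      = (idn B \<star> u) \<odot> (flip A B \<star> idn D)"
    unfolding 1 using assms by simp
  from arg_cong[OF this, of "\<lambda>s. (flip B A \<star> idn D) \<odot> s"] show ?thesis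
    using assms by (simp add: 2)
qed

end

section \<open>Images in categories of representations\<close>

context hilbert_functor
begin

definition leg :: "'o \<Rightarrow> 'o \<Rightarrow> 'o \<Rightarrow> ('o, 'a) typed \<Rightarrow> ('o, 'a) typed" where
  "leg A B D u = (idn A \<star> flip D B) \<odot> (u \<star> idn B) \<odot> (idn A \<star> flip B D)"

lemma
  assumes "A \<in> Obj T" "B \<in> Obj T" "D \<in> Obj T" "H B = B" "H D = D"
    and "typed u" "src u = A \<otimes> D" "tgt u = A \<otimes> D"
  shows typed_leg: "typed (leg A B D u)" "src (leg A B D u) = A \<otimes> B \<otimes> D" "tgt (leg A B D u) = A \<otimes> B \<otimes> D"
    and adj_leg: "adj (leg A B D u) = leg A B D (adj u)"
  using assms by (simp_all add: leg_def adj_flip)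

lemma unitary_iff:
  assumes "typed u"
  shows "unitary T (src u) (tgt u) (arr u) \<longleftrightarrow> adj u \<odot> u = idn (src u) \<and> u \<odot> adj u = idn (tgt u)"
proof -
  have "adj u \<odot> u = idn (src u) \<longleftrightarrow> (arr u)\<^sup>\<dagger> \<cdot> arr u = \<one> (src u)"
    "u \<odot> adj u = idn (tgt u) \<longleftrightarrow> arr u \<cdot> (arr u)\<^sup>\<dagger> = \<one> (tgt u)"
    by (auto simp: seq_def idn_def adj_def)
  then show ?thesis using assms by (simp add: unitary_def)
qed

text \<open>The part common to representations and corepresentations, with \<open>w X\<close> the
  one carried by \<open>X\<close>. Keeping \<open>X\<close> in the pair makes the map injective on
  objects even where \<open>\<iota>\<close> is not; on arrows injectivity is faithfulness.\<close>

lemma image_tensor_subcategory: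
  fixes C :: "('o \<times> 'a, 'a) tcat"
  assumes ops: "Comp C = Comp T" "Adj C = Adj T" "TensAr C = TensAr T"
    and ob: "\<And>X. X \<in> Obj T \<Longrightarrow> (X, w X) \<in> Obj C"
    and id: "\<And>X. X \<in> Obj T \<Longrightarrow> \<one>\<^bsub>C\<^esub> (X, w X) = \<one> (H X)"
    and unit: "\<U>\<^bsub>C\<^esub> = (\<U>, w \<U>)"
    and tens: "\<And>X Y. X \<in> Obj T \<Longrightarrow> Y \<in> Obj T \<Longrightarrow> (X, w X) \<otimes>\<^bsub>C\<^esub> (Y, w Y) = (X \<otimes> Y, w (X \<otimes> Y))"
    and hom: "\<And>X Y f. \<lbrakk>X \<in> Obj T; Y \<in> Obj T; f \<in> Hom T X Y\<rbrakk> \<Longrightarrow> on_ar \<iota> f \<in> Hom C (X, w X) (Y, w Y)"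
  shows "\<exists>S. tensor_subcategory S C \<and> tensor_star_isomorphism T S \<lparr>on_ob = (\<lambda>X. (X, w X)), on_ar = on_ar \<iota>\<rparr>"
proof -
  define S where "S = C\<lparr>Obj := (\<lambda>X. (X, w X)) ` Obj T, Hom := \<lambda>p q. on_ar \<iota> ` Hom T (fst p) (fst q)\<rparr>"
  have S: "Obj S = (\<lambda>X. (X, w X)) ` Obj T" "Hom S = (\<lambda>p q. on_ar \<iota> ` Hom T (fst p) (fst q))"
    "Comp S = Comp T" "Adj S = Adj T" "TensAr S = TensAr T" "Id S = Id C" "Unit S = Unit C" "TensOb S = TensOb C"
    by (simp_all add: S_def ops)
  have sub: "csubspace (on_ar \<iota> ` Hom T X Y)" if "X \<in> Obj T" "Y \<in> Obj T" for X Y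
    unfolding csubspace_def
  proof (intro conjI ballI allI)
    have "on_ar \<iota> 0 = 0" using F_scale[OF that zero_in[OF that], of 0] by (simp add: scaleC_zero)
    then show "0 \<in> on_ar \<iota> ` Hom T X Y" using imageI[OF zero_in[OF that], of "on_ar \<iota>"] by simp
  next
    fix x y assume "x \<in> on_ar \<iota> ` Hom T X Y" "y \<in> on_ar \<iota> ` Hom T X Y"
    then obtain f g where "f \<in> Hom T X Y" "x = on_ar \<iota> f" "g \<in> Hom T X Y" "y = on_ar \<iota> g" by blast
    then show "x + y \<in> on_ar \<iota> ` Hom T X Y"
      using F_add[OF that, of f g] imageI[OF add_in[OF that, of f g], of "on_ar \<iota>"] by simp
  next
    fix c x assume "x \<in> on_ar \<iota> ` Hom T X Y"
    then obtain f where "f \<in> Hom T X Y" "x = on_ar \<iota> f" by blast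
    then show "c *\<^sub>C x \<in> on_ar \<iota> ` Hom T X Y"
      using F_scale[OF that, of f c] imageI[OF scale_in[OF that, of f c], of "on_ar \<iota>"] by simp
  qed
  have "tensor_subcategory S C"
    unfolding tensor_subcategory_def
  proof (intro conjI)
    show "S = C\<lparr>Obj := Obj S, Hom := Hom S\<rparr>" by (simp add: S_def)
    show "Obj S \<subseteq> Obj C" using ob by (auto simp: S)
    show "\<U>\<^bsub>C\<^esub> \<in> Obj S" by (simp add: S unit)
    show "\<forall>X\<in>Obj S. \<forall>Y\<in>Obj S. X \<otimes>\<^bsub>C\<^esub> Y \<in> Obj S" by (simp add: S tens)
    show "\<forall>X\<in>Obj S. \<one>\<^bsub>C\<^esub> X \<in> Hom S X X"
    proof
      fix p assume "p \<in> Obj S"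
      then obtain X where X: "X \<in> Obj T" "p = (X, w X)" by (auto simp: S)
      have "on_ar \<iota> (\<one> X) \<in> on_ar \<iota> ` Hom T X X" using id_in[OF X(1)] by (rule imageI)
      then show "\<one>\<^bsub>C\<^esub> p \<in> Hom S p p" using X by (simp add: S id F_id)
    qed
    show "\<forall>X\<in>Obj S. \<forall>Y\<in>Obj S. Hom S X Y \<subseteq> Hom C X Y \<and> csubspace (Hom S X Y) \<and>
        (\<forall>f\<in>Hom S X Y. f\<^sup>\<dagger>\<^bsub>C\<^esub> \<in> Hom S Y X)"
    proof (intro ballI conjI)
      fix p q assume "p \<in> Obj S" "q \<in> Obj S"
      then obtain X Y where X: "X \<in> Obj T" "Y \<in> Obj T" "p = (X, w X)" "q = (Y, w Y)" by (auto simp: S)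
      show "Hom S p q \<subseteq> Hom C p q" using hom[OF X(1,2)] by (auto simp: S X)
      show "csubspace (Hom S p q)" using sub[OF X(1,2)] by (simp add: S X)
      fix f assume "f \<in> Hom S p q"
      then obtain g where g: "g \<in> Hom T X Y" "f = on_ar \<iota> g" by (auto simp: S X)
      show "f\<^sup>\<dagger>\<^bsub>C\<^esub> \<in> Hom S q p"
        using imageI[OF adj_in[OF X(1,2) g(1)], of "on_ar \<iota>"] by (simp add: S X ops g F_adj[OF X(1,2) g(1)])
    qed
    show "\<forall>X\<in>Obj S. \<forall>Y\<in>Obj S. \<forall>Z\<in>Obj S. \<forall>f\<in>Hom S X Y. \<forall>g\<in>Hom S Y Z. g \<cdot>\<^bsub>C\<^esub> f \<in> Hom S X Z"
    proof (intro ballI)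
      fix p q r f g assume "p \<in> Obj S" "q \<in> Obj S" "r \<in> Obj S" and fg: "f \<in> Hom S p q" "g \<in> Hom S q r"
      then obtain X Y Z where X: "X \<in> Obj T" "Y \<in> Obj T" "Z \<in> Obj T"
        and p: "p = (X, w X)" "q = (Y, w Y)" "r = (Z, w Z)" by (auto simp: S)
      obtain f' g' where f: "f' \<in> Hom T X Y" "g' \<in> Hom T Y Z" "f = on_ar \<iota> f'" "g = on_ar \<iota> g'"
        using fg by (auto simp: S p)
      show "g \<cdot>\<^bsub>C\<^esub> f \<in> Hom S p r"
        using imageI[OF comp_in[OF X f(1,2)], of "on_ar \<iota>"] by (simp add: S ops p f F_comp[OF X f(1,2)])
    qed
    show "\<forall>X\<in>Obj S. \<forall>Y\<in>Obj S. \<forall>X'\<in>Obj S. \<forall>Y'\<in>Obj S. \<forall>f\<in>Hom S X Y. \<forall>g\<in>Hom S X' Y'.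
        f \<boxtimes>\<^bsub>C\<^esub> g \<in> Hom S (X \<otimes>\<^bsub>C\<^esub> X') (Y \<otimes>\<^bsub>C\<^esub> Y')"
    proof (intro ballI)
      fix p q p' q' f g assume "p \<in> Obj S" "q \<in> Obj S" "p' \<in> Obj S" "q' \<in> Obj S"
        and fg: "f \<in> Hom S p q" "g \<in> Hom S p' q'"
      then obtain X Y X' Y' where X: "X \<in> Obj T" "Y \<in> Obj T" "X' \<in> Obj T" "Y' \<in> Obj T"
        and p: "p = (X, w X)" "q = (Y, w Y)" "p' = (X', w X')" "q' = (Y', w Y')" by (auto simp: S)
      obtain f' g' where f: "f' \<in> Hom T X Y" "g' \<in> Hom T X' Y'" "f = on_ar \<iota> f'" "g = on_ar \<iota> g'"
        using fg by (auto simp: S p)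
      show "f \<boxtimes>\<^bsub>C\<^esub> g \<in> Hom S (p \<otimes>\<^bsub>C\<^esub> p') (q \<otimes>\<^bsub>C\<^esub> q')"
        using imageI[OF tens_in[OF X f(1,2)], of "on_ar \<iota>"]
        by (simp add: S ops p f F_tens[OF X f(1,2)] tens X)
    qed
  qed
  moreover have "tensor_star_isomorphism T S \<lparr>on_ob = (\<lambda>X. (X, w X)), on_ar = on_ar \<iota>\<rparr>"
    unfolding tensor_star_isomorphism_def
  proof (intro conjI ballI)
    show "tensor_star_functor T S \<lparr>on_ob = (\<lambda>X. (X, w X)), on_ar = on_ar \<iota>\<rparr>"
      by unfold_locales (simp_all only: functor_maps.simps S image_eqI imageI fst_conv id F_id F_comp F_add
        F_scale F_adj unit tens F_tens)
    show "bij_betw (on_ob \<lparr>on_ob = (\<lambda>X. (X, w X)), on_ar = on_ar \<iota>\<rparr>) (Obj T) (Obj S)"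
      by (auto simp: bij_betw_def inj_on_def S)
    fix X Y assume "X \<in> Obj T" "Y \<in> Obj T"
    then show "bij_betw (on_ar \<lparr>on_ob = (\<lambda>X. (X, w X)), on_ar = on_ar \<iota>\<rparr>) (Hom T X Y)
        (Hom S (on_ob \<lparr>on_ob = (\<lambda>X. (X, w X)), on_ar = on_ar \<iota>\<rparr> X) (on_ob \<lparr>on_ob = (\<lambda>X. (X, w X)), on_ar = on_ar \<iota>\<rparr> Y))"
      using iota_faithful by (simp add: bij_betw_def S faithful_def)
  qed
  ultimately show ?thesis by blast
qed

end

section \<open>Regular objects\<close>

locale right_regular_object = hilbert_functor +
  fixes V :: 'a and \<eta> :: "'a \<Rightarrow> 'b"
  assumes V [simp]: "V \<in> Obj T" and right_regular: "right_regular T \<iota> \<theta> V \<eta>"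
begin

definition E :: "'a \<Rightarrow> ('a, 'b) typed" where "E W = (W \<otimes> V, \<eta> W, H W \<otimes> V)"

lemma E_components [simp]: "src (E W) = W \<otimes> V" "arr (E W) = \<eta> W" "tgt (E W) = H W \<otimes> V"
  by (simp_all add: E_def)

lemma eta_unitary: "W \<in> Obj T \<Longrightarrow> unitary T (W \<otimes> V) (H W \<otimes> V) (\<eta> W)"
  using right_regular
  by (simp add: right_regular_def unitary_nat_trans_def right_tensor_def functor_comp_def)

lemma typed_E [simp]: "W \<in> Obj T \<Longrightarrow> typed (E W)"
  using eta_unitary[of W] by (simp add: typed_def unitary_def)

lemma E_adj [simp]: "W \<in> Obj T \<Longrightarrow> adj (E W) \<odot> E W = idn (W \<otimes> V)" "W \<in> Obj T \<Longrightarrow> E W \<odot> adj (E W) = idn (H W \<otimes> V)"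
  using eta_unitary[of W] unitary_iff[of "E W"] by simp_all

lemma E_natural: "typed f \<Longrightarrow> E (tgt f) \<odot> (f \<star> idn V) = (iot f \<star> idn V) \<odot> E (src f)"
  using right_regular typedD[of f]
  by (intro typed_eqI) (simp_all add: right_regular_def unitary_nat_trans_def right_tensor_def functor_comp_def)

lemma E_tens:
  assumes "W \<in> Obj T" "W' \<in> Obj T"
  shows "E (W \<otimes> W') = (idn (H W) \<star> flip V (H W')) \<odot> (E W \<star> idn (H W')) \<odot> (idn W \<star> flip (H W') V)
    \<odot> (idn W \<star> E W')"
proof -
  have "E (W \<otimes> W') = ((idn (H W) \<star> flip V (H W')) \<odot> (E W \<star> idn (H W')) \<odot> (idn W \<star> flip (H W') V))
      \<odot> (idn W \<star> E W')"
    using right_regular assms by (intro typed_eqI) (simp_all add: right_regular_def del: seq_assoc)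
  then show ?thesis using assms by simp
qed

lemma E_unit: "E \<U> = idn V"
proof -
  have "E \<U> \<odot> E \<U> = E \<U>" using E_tens[of \<U> \<U>] by (simp add: flip_unit)
  then have "adj (E \<U>) \<odot> E \<U> \<odot> E \<U> = adj (E \<U>) \<odot> E \<U>" by simp
  then show ?thesis by (simp add: seq_assoc[symmetric] del: seq_assoc)
qed

lemma E_hilbert:
  assumes W: "W \<in> Obj T" shows "E (H W) = idn (H W \<otimes> V)"
proof -
  have "\<eta> (H W) = \<one> (H W \<otimes> V)"
  proof (rule unitary_fixing_units_right[OF W V])
    show "unitary T (H W \<otimes> V) (H W \<otimes> V) (\<eta> (H W))" using eta_unitary[of "H W"] W by simp
    fix s assume s: "s \<in> Hom T \<U> (H W)"
    \<comment> \<open>Since \<open>\<iota>\<close> fixes \<open>s\<close>, naturality relates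
      \<open>\<eta>\<close> at \<open>H W\<close> to its trivial value at the unit.\<close>
    have s': "typed (\<U>, s, H W)" "iot (\<U>, s, H W) = (\<U>, s, H W)"
      using s W iota_fixes[of \<U> W s] by (simp_all add: typed_def iot_def)
    show "\<eta> (H W) \<cdot> (s \<boxtimes> \<one> V) = s \<boxtimes> \<one> V"
      using arg_cong[OF E_natural[OF s'(1)], of arr] s' W by (simp add: E_unit)
  qed
  then show ?thesis using W by (intro typed_eqI) simp_all
qed

text \<open>Under \<open>\<iota>\<close> the mixed flips become flips of Hilbert spaces, and the
  tensor formula becomes the tensor product of representations.\<close>

lemma iot_E_tens:
  assumes "W \<in> Obj T" "W' \<in> Obj T"
  shows "iot (E (W \<otimes> W')) = leg (H W) (H W') (H V) (iot (E W)) \<odot> (idn (H W) \<star> iot (E W'))"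
  using assms by (simp add: leg_def E_tens)

lemma rep_identity:
  assumes W: "W \<in> Obj T"
  shows "(iot (E W) \<star> idn (H V)) \<odot> leg (H W) (H V) (H V) (iot (E W)) \<odot> (idn (H W) \<star> iot (E V))
    = (idn (H W) \<star> iot (E V)) \<odot> (iot (E W) \<star> idn (H V))"
proof -
  have "(idn (H W) \<star> flip V (H V)) \<odot> (idn (H W) \<star> flip (H V) V) = idn (H W \<otimes> H V \<otimes> V)"
    using W by (simp add: interchange flip_flip)
  \<comment> \<open>With \<open>\<eta>\<close> trivial at \<open>H W\<close>, the first leg of the
    tensor formula consists of two cancelling flips.\<close>
  then have 1: "E (H W \<otimes> V) = idn (H W) \<star> E V"
    using W by (simp add: E_tens E_hilbert seq_assoc[symmetric] del: seq_assoc)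
  have "(idn (H W) \<star> E V) \<odot> (E W \<star> idn V) = (iot (E W) \<star> idn V) \<odot> E (W \<otimes> V)"
    using E_natural[of "E W"] W by (simp add: 1)
  from arg_cong[OF this, of iot] show ?thesis
    using W typed_leg[of "H W" "H V" "H V" "iot (E W)"] by (simp add: iot_E_tens)
qed

lemma iot_E_unitary:
  assumes W: "W \<in> Obj T"
  shows "unitary T (H W \<otimes> H V) (H W \<otimes> H V) (on_ar \<iota> (\<eta> W))"
proof -
  have "adj (iot (E W)) \<odot> iot (E W) = iot (adj (E W) \<odot> E W)" "iot (E W) \<odot> adj (iot (E W)) = iot (E W \<odot> adj (E W))"
    using W by (simp_all del: E_adj)
  then show ?thesis using W unitary_iff[of "iot (E W)"] by simp
qed

lemma eta_representation:
  assumes W: "W \<in> Obj T"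
  shows "representation (hilbert_copies T \<iota>) (hilbert_flip \<iota> \<theta>) (H V) (on_ar \<iota> (\<eta> V)) W (on_ar \<iota> (\<eta> W))"
  using arg_cong[OF rep_identity[OF W], of arr] iot_E_unitary[OF W] W
  by (simp add: representation_def copies_simps leg13_def leg_def hilbert_flip_def unitary_def del: seq_assoc)

text \<open>A multiplicative unitary is one that represents itself: the case
  \<open>W = V\<close>.\<close>

lemma eta_multiplicative_unitary: "multiplicative_unitary (functor_image T \<iota>) \<theta> (H V) (on_ar \<iota> (\<eta> V))"
  using arg_cong[OF rep_identity[OF V], of arr] iot_E_unitary[OF V] image_hom[of "V \<otimes> V" "V \<otimes> V"]
  by (simp add: multiplicative_unitary_def image_simps leg13_def leg_def unitary_def del: seq_assoc)

lemma rep_subcategory: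
  "\<exists>S. tensor_subcategory S
         (rep_category (hilbert_copies T \<iota>) (hilbert_flip \<iota> \<theta>) (H V) (on_ar \<iota> (\<eta> V)))
     \<and> tensor_star_isomorphism T S \<lparr>on_ob = (\<lambda>W. (W, on_ar \<iota> (\<eta> W))), on_ar = on_ar \<iota>\<rparr>"
proof (rule image_tensor_subcategory)
  let ?C = "rep_category (hilbert_copies T \<iota>) (hilbert_flip \<iota> \<theta>) (H V) (on_ar \<iota> (\<eta> V))"
  show "Comp ?C = Comp T" "Adj ?C = Adj T" "TensAr ?C = TensAr T"
    by (simp_all add: rep_category_def copies_simps)
  show "\<U>\<^bsub>?C\<^esub> = (\<U>, on_ar \<iota> (\<eta> \<U>))"
    using arg_cong[OF E_unit, of arr] by (simp add: rep_category_def copies_simps F_id)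
  fix X assume X: "X \<in> Obj T"
  show "(X, on_ar \<iota> (\<eta> X)) \<in> Obj ?C" using eta_representation[OF X] by (simp add: rep_category_def)
  show "\<one>\<^bsub>?C\<^esub> (X, on_ar \<iota> (\<eta> X)) = \<one> (H X)" by (simp add: rep_category_def copies_simps)
  fix Y assume Y: "Y \<in> Obj T"
  show "(X, on_ar \<iota> (\<eta> X)) \<otimes>\<^bsub>?C\<^esub> (Y, on_ar \<iota> (\<eta> Y)) = (X \<otimes> Y, on_ar \<iota> (\<eta> (X \<otimes> Y)))"
    using arg_cong[OF iot_E_tens[OF X Y], of arr] X Y
    by (simp add: rep_category_def copies_simps leg13_def leg_def hilbert_flip_def del: seq_assoc)
  fix f assume f: "f \<in> Hom T X Y"
  have "typed (X, f, Y)" using X Y f by (simp add: typed_def)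
  from arg_cong[OF arg_cong[OF E_natural[OF this], of iot], of arr] this
  show "on_ar \<iota> f \<in> Hom ?C (X, on_ar \<iota> (\<eta> X)) (Y, on_ar \<iota> (\<eta> Y))"
    using X Y F_in[OF X Y f] by (simp add: rep_category_def copies_simps)
qed

end

section \<open>Left regularity and corepresentations\<close>

locale left_regular_object = hilbert_functor +
  fixes V :: 'a and \<xi> :: "'a \<Rightarrow> 'b"
  assumes V [simp]: "V \<in> Obj T" and left_regular: "left_regular T \<iota> \<theta> \<xi> V"
begin

definition L :: "'a \<Rightarrow> ('a, 'b) typed" where "L W = (V \<otimes> W, \<xi> W, V \<otimes> H W)"

lemma L_components [simp]: "src (L W) = V \<otimes> W" "arr (L W) = \<xi> W" "tgt (L W) = V \<otimes> H W"
  by (simp_all add: L_def)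

lemma xi_unitary: "W \<in> Obj T \<Longrightarrow> unitary T (V \<otimes> W) (V \<otimes> H W) (\<xi> W)"
  using left_regular
  by (simp add: left_regular_def unitary_nat_trans_def left_tensor_def functor_comp_def)

lemma typed_L [simp]: "W \<in> Obj T \<Longrightarrow> typed (L W)"
  using xi_unitary[of W] by (simp add: typed_def unitary_def)

lemma L_adj [simp]: "W \<in> Obj T \<Longrightarrow> adj (L W) \<odot> L W = idn (V \<otimes> W)" "W \<in> Obj T \<Longrightarrow> L W \<odot> adj (L W) = idn (V \<otimes> H W)"
  using xi_unitary[of W] unitary_iff[of "L W"] by simp_all

lemma L_natural: "typed f \<Longrightarrow> L (tgt f) \<odot> (idn V \<star> f) = (idn V \<star> iot f) \<odot> L (src f)"
  using left_regular typedD[of f]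
  by (intro typed_eqI) (simp_all add: left_regular_def unitary_nat_trans_def left_tensor_def functor_comp_def)

lemma L_tens:
  assumes "W \<in> Obj T" "W' \<in> Obj T"
  shows "L (W \<otimes> W') = (flip (H W) V \<star> idn (H W')) \<odot> (idn (H W) \<star> L W') \<odot> (flip V (H W) \<star> idn W')
    \<odot> (L W \<star> idn W')"
proof -
  have "L (W \<otimes> W') = ((flip (H W) V \<star> idn (H W')) \<odot> (idn (H W) \<star> L W') \<odot> (flip V (H W) \<star> idn W'))
      \<odot> (L W \<star> idn W')"
    using left_regular assms by (intro typed_eqI) (simp_all add: left_regular_def del: seq_assoc)
  then show ?thesis using assms by simp
qed

lemma L_unit: "L \<U> = idn V"
proof -
  have "L \<U> \<odot> L \<U> = L \<U>" using L_tens[of \<U> \<U>] by (simp add: flip_unit)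
  then have "adj (L \<U>) \<odot> L \<U> \<odot> L \<U> = adj (L \<U>) \<odot> L \<U>" by simp
  then show ?thesis by (simp add: seq_assoc[symmetric] del: seq_assoc)
qed

lemma L_hilbert:
  assumes W: "W \<in> Obj T" shows "L (H W) = idn (V \<otimes> H W)"
proof -
  have "\<xi> (H W) = \<one> (V \<otimes> H W)"
  proof (rule unitary_fixing_units_left[OF W V])
    show "unitary T (V \<otimes> H W) (V \<otimes> H W) (\<xi> (H W))" using xi_unitary[of "H W"] W by simp
    fix s assume s: "s \<in> Hom T \<U> (H W)"
    have s': "typed (\<U>, s, H W)" "iot (\<U>, s, H W) = (\<U>, s, H W)"
      using s W iota_fixes[of \<U> W s] by (simp_all add: typed_def iot_def)
    show "\<xi> (H W) \<cdot> (\<one> V \<boxtimes> s) = \<one> V \<boxtimes> s"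
      using arg_cong[OF L_natural[OF s'(1)], of arr] s' W by (simp add: L_unit)
  qed
  then show ?thesis using W by (intro typed_eqI) simp_all
qed

text \<open>Left regularity moves the middle factor past \<open>V\<close>, whereas
  \<open>leg\<close> moves it past the last factor; \<open>leg13_flip\<close> reconciles the
  two.\<close>

lemma iot_L_tens:
  assumes "W \<in> Obj T" "W' \<in> Obj T"
  shows "iot (L (W \<otimes> W')) = leg (H V) (H W) (H W') (iot (L W')) \<odot> (iot (L W) \<star> idn (H W'))"
proof -
  have "iot (L (W \<otimes> W')) = ((flip (H W) (H V) \<star> idn (H W')) \<odot> (idn (H W) \<star> iot (L W'))
      \<odot> (flip (H V) (H W) \<star> idn (H W'))) \<odot> (iot (L W) \<star> idn (H W'))"
    using assms by (simp add: L_tens)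
  then show ?thesis
    using assms by (subst (asm) leg13_flip) (simp_all only: leg_def, simp_all)
qed

text \<open>Naturality of \<open>\<xi>\<close> on \<open>\<xi>\<close> itself yields the
  corepresentation identity with all products reversed. Adjoints restore the order, which is why the
  inverse of \<open>\<xi>\<close> appears.\<close>

lemma corep_identity:
  assumes W: "W \<in> Obj T"
  shows "(adj (iot (L V)) \<star> idn (H W)) \<odot> leg (H V) (H V) (H W) (adj (iot (L W))) \<odot> (idn (H V) \<star> adj (iot (L W)))
    = (idn (H V) \<star> adj (iot (L W))) \<odot> (adj (iot (L V)) \<star> idn (H W))"
proof -
  have "(flip (H V) V \<star> idn (H W)) \<odot> (flip V (H V) \<star> idn (H W)) = idn (V \<otimes> H V \<otimes> H W)"
    using W by (simp add: interchange flip_flip)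
  then have 1: "L (V \<otimes> H W) = L V \<star> idn (H W)"
    using W by (simp add: L_tens L_hilbert seq_assoc[symmetric] del: seq_assoc)
  have "(L V \<star> idn (H W)) \<odot> (idn V \<star> L W) = (idn V \<star> iot (L W)) \<odot> L (V \<otimes> W)"
    using L_natural[of "L W"] W by (simp add: 1)
  then have "adj (iot ((L V \<star> idn (H W)) \<odot> (idn V \<star> L W))) = adj (iot ((idn V \<star> iot (L W)) \<odot> L (V \<otimes> W)))"
    by simp
  then show ?thesis
    using W typed_leg[of "H V" "H V" "H W" "iot (L W)"] typed_leg[of "H V" "H V" "H W" "adj (iot (L W))"]
    by (simp add: iot_L_tens adj_leg)
qed

lemma iot_L_unitary:
  assumes W: "W \<in> Obj T"
  shows "unitary T (H V \<otimes> H W) (H V \<otimes> H W) ((on_ar \<iota> (\<xi> W))\<^sup>\<dagger>)"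
proof -
  have "adj (iot (L W)) \<odot> iot (L W) = iot (adj (L W) \<odot> L W)" "iot (L W) \<odot> adj (iot (L W)) = iot (L W \<odot> adj (L W))"
    using W by (simp_all del: L_adj)
  then show ?thesis using W unitary_iff[of "adj (iot (L W))"] by simp
qed

lemma xi_corepresentation:
  assumes W: "W \<in> Obj T"
  shows "corepresentation (hilbert_copies T \<iota>) (hilbert_flip \<iota> \<theta>) (H V) ((on_ar \<iota> (\<xi> V))\<^sup>\<dagger>) W ((on_ar \<iota> (\<xi> W))\<^sup>\<dagger>)"
  using arg_cong[OF corep_identity[OF W], of arr] iot_L_unitary[OF W] W
  by (simp add: corepresentation_def copies_simps leg13_def leg_def hilbert_flip_def unitary_def del: seq_assoc)

lemma xi_multiplicative_unitary: "multiplicative_unitary (functor_image T \<iota>) \<theta> (H V) ((on_ar \<iota> (\<xi> V))\<^sup>\<dagger>)"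
  using arg_cong[OF corep_identity[OF V], of arr] iot_L_unitary[OF V] image_hom[of "V \<otimes> V" "V \<otimes> V"]
  by (simp add: multiplicative_unitary_def image_simps leg13_def leg_def unitary_def del: seq_assoc)

lemma corep_subcategory:
  "\<exists>S. tensor_subcategory S
         (corep_category (hilbert_copies T \<iota>) (hilbert_flip \<iota> \<theta>) (H V) ((on_ar \<iota> (\<xi> V))\<^sup>\<dagger>))
     \<and> tensor_star_isomorphism T S \<lparr>on_ob = (\<lambda>W. (W, (on_ar \<iota> (\<xi> W))\<^sup>\<dagger>)), on_ar = on_ar \<iota>\<rparr>"
proof (rule image_tensor_subcategory)
  let ?C = "corep_category (hilbert_copies T \<iota>) (hilbert_flip \<iota> \<theta>) (H V) ((on_ar \<iota> (\<xi> V))\<^sup>\<dagger>)"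
  show "Comp ?C = Comp T" "Adj ?C = Adj T" "TensAr ?C = TensAr T"
    by (simp_all add: corep_category_def copies_simps)
  show "\<U>\<^bsub>?C\<^esub> = (\<U>, (on_ar \<iota> (\<xi> \<U>))\<^sup>\<dagger>)"
    using arg_cong[OF L_unit, of arr] by (simp add: corep_category_def copies_simps F_id id_adj)
  fix X assume X: "X \<in> Obj T"
  show "(X, (on_ar \<iota> (\<xi> X))\<^sup>\<dagger>) \<in> Obj ?C" using xi_corepresentation[OF X] by (simp add: corep_category_def)
  show "\<one>\<^bsub>?C\<^esub> (X, (on_ar \<iota> (\<xi> X))\<^sup>\<dagger>) = \<one> (H X)" by (simp add: corep_category_def copies_simps)
  fix Y assume Y: "Y \<in> Obj T"
  \<comment> \<open>The adjoint also puts the two legs of the tensor formula in the order used for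
    corepresentations.\<close>
  have "adj (iot (L (X \<otimes> Y))) = (adj (iot (L X)) \<star> idn (H Y)) \<odot> leg (H V) (H X) (H Y) (adj (iot (L Y)))"
    using X Y typed_leg[of "H V" "H X" "H Y" "iot (L Y)"] by (simp add: iot_L_tens adj_leg)
  from arg_cong[OF this, of arr]
  show "(X, (on_ar \<iota> (\<xi> X))\<^sup>\<dagger>) \<otimes>\<^bsub>?C\<^esub> (Y, (on_ar \<iota> (\<xi> Y))\<^sup>\<dagger>) = (X \<otimes> Y, (on_ar \<iota> (\<xi> (X \<otimes> Y)))\<^sup>\<dagger>)"
    using X Y by (simp add: corep_category_def copies_simps leg13_def leg_def hilbert_flip_def del: seq_assoc)
  fix f assume f: "f \<in> Hom T X Y"
  define t where "t = (X, f, Y)"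
  have t: "typed t" "src t = X" "arr t = f" "tgt t = Y" using X Y f by (simp_all add: typed_def t_def)
  \<comment> \<open>Naturality of \<open>\<xi>\<close> is multiplied by its inverses on both sides
    to give naturality of the inverse.\<close>
  have "adj (L Y) \<odot> (L Y \<odot> (idn V \<star> t)) \<odot> adj (L X) = adj (L Y) \<odot> ((idn V \<star> iot t) \<odot> L X) \<odot> adj (L X)"
    using L_natural[OF t(1)] by (simp only: t)
  moreover have "adj (L Y) \<odot> (L Y \<odot> (idn V \<star> t)) \<odot> adj (L X) = (idn V \<star> t) \<odot> adj (L X)"
    using X Y t by (simp add: seq_assoc[symmetric] del: seq_assoc)
  ultimately have "(idn V \<star> t) \<odot> adj (L X) = adj (L Y) \<odot> (idn V \<star> iot t)"
    using X Y t by simp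
  from arg_cong[OF arg_cong[OF this, of iot], of arr]
  show "on_ar \<iota> f \<in> Hom ?C (X, (on_ar \<iota> (\<xi> X))\<^sup>\<dagger>) (Y, (on_ar \<iota> (\<xi> Y))\<^sup>\<dagger>)"
    using X Y t F_in[OF X Y f] by (simp add: corep_category_def copies_simps)
qed

end

section \<open>The standard braided symmetry\<close>

locale regular_triple = right_regular_object T \<iota> \<theta> V \<eta> + left_regular_object T \<iota> \<theta> V \<xi>
  for T :: "('o, 'a::complex_normed_vector) tcat" (structure) and \<iota> \<theta> V \<xi> \<eta> +
  assumes regular: "regular_object T \<iota> \<theta> \<xi> V \<eta>"
begin

lemma E_L_commute:
  assumes "W \<in> Obj T" "W' \<in> Obj T"
  shows "(E W \<star> idn (H W')) \<odot> (idn W \<star> L W') = (idn (H W) \<star> L W') \<odot> (E W \<star> idn W')"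
  using assms regular by (intro typed_eqI) (simp_all add: regular_object_def)

text \<open>Standardness prescribes this arrow as the composite of the braiding with
  \<open>\<xi>\<close>. Absorbing the flip into \<open>\<eta>\<close> frees its tensor formula of
  flips.\<close>

definition swap_eta :: "'o \<Rightarrow> ('o, 'a) typed" where "swap_eta W = flip (H W) V \<odot> E W"

definition braiding :: "'o \<Rightarrow> ('o, 'a) typed" where "braiding W = adj (L W) \<odot> swap_eta W"

lemma swap_eta_simps [simp]:
  assumes "W \<in> Obj T"
  shows "typed (swap_eta W)" "src (swap_eta W) = W \<otimes> V" "tgt (swap_eta W) = V \<otimes> H W"
  using assms by (simp_all add: swap_eta_def)

lemma braiding_simps [simp]:
  assumes "W \<in> Obj T"
  shows "typed (braiding W)" "src (braiding W) = W \<otimes> V" "tgt (braiding W) = V \<otimes> W"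
  using assms by (simp_all add: braiding_def)

lemma swap_eta_unitary:
  assumes "W \<in> Obj T"
  shows "adj (swap_eta W) \<odot> swap_eta W = idn (W \<otimes> V)" "swap_eta W \<odot> adj (swap_eta W) = idn (V \<otimes> H W)"
proof -
  have "adj (swap_eta W) \<odot> swap_eta W = adj (E W) \<odot> (flip V (H W) \<odot> flip (H W) V) \<odot> E W"
    using assms by (simp add: swap_eta_def adj_flip)
  then show "adj (swap_eta W) \<odot> swap_eta W = idn (W \<otimes> V)" using assms by (simp add: flip_flip)
  have "swap_eta W \<odot> adj (swap_eta W) = flip (H W) V \<odot> (E W \<odot> adj (E W)) \<odot> flip V (H W)"
    using assms by (simp add: swap_eta_def adj_flip del: E_adj)
  then show "swap_eta W \<odot> adj (swap_eta W) = idn (V \<otimes> H W)" using assms by (simp add: flip_flip)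
qed

lemma L_braiding: "W \<in> Obj T \<Longrightarrow> L W \<odot> braiding W = swap_eta W"
  by (simp add: braiding_def seq_assoc[symmetric] del: seq_assoc)

lemma braiding_unitary:
  assumes "W \<in> Obj T"
  shows "adj (braiding W) \<odot> braiding W = idn (W \<otimes> V)" "braiding W \<odot> adj (braiding W) = idn (V \<otimes> W)"
proof -
  have "adj (braiding W) \<odot> braiding W = adj (swap_eta W) \<odot> (L W \<odot> adj (L W)) \<odot> swap_eta W"
    using assms by (simp add: braiding_def del: L_adj)
  then show "adj (braiding W) \<odot> braiding W = idn (W \<otimes> V)" using assms by (simp add: swap_eta_unitary)
  have "braiding W \<odot> adj (braiding W) = adj (L W) \<odot> (swap_eta W \<odot> adj (swap_eta W)) \<odot> L W"
    using assms by (simp add: braiding_def del: L_adj)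
  then show "braiding W \<odot> adj (braiding W) = idn (V \<otimes> W)" using assms by (simp add: swap_eta_unitary)
qed

lemma swap_eta_natural:
  assumes "typed f"
  shows "swap_eta (tgt f) \<odot> (f \<star> idn V) = (idn V \<star> iot f) \<odot> swap_eta (src f)"
proof -
  have "swap_eta (tgt f) \<odot> (f \<star> idn V) = (flip (H (tgt f)) V \<odot> (iot f \<star> idn V)) \<odot> E (src f)"
    using assms by (simp add: swap_eta_def E_natural)
  also have "\<dots> = ((idn V \<star> iot f) \<odot> flip (H (src f)) V) \<odot> E (src f)"
    using flip_natural[of "iot f" "idn V"] assms by simp
  finally show ?thesis using assms by (simp add: swap_eta_def)
qed

lemma braiding_natural:
  assumes f: "typed f"
  shows "braiding (tgt f) \<odot> (f \<star> idn V) = (idn V \<star> f) \<odot> braiding (src f)"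
proof -
  have "L (tgt f) \<odot> (idn V \<star> f) \<odot> braiding (src f) = (L (tgt f) \<odot> (idn V \<star> f)) \<odot> braiding (src f)"
    using f by simp
  also have "\<dots> = (idn V \<star> iot f) \<odot> swap_eta (src f)"
    using f by (simp add: L_natural L_braiding)
  finally have "adj (L (tgt f)) \<odot> L (tgt f) \<odot> (idn V \<star> f) \<odot> braiding (src f)
      = adj (L (tgt f)) \<odot> swap_eta (tgt f) \<odot> (f \<star> idn V)"
    using swap_eta_natural[OF f] by simp
  moreover have "adj (L (tgt f)) \<odot> L (tgt f) \<odot> (idn V \<star> f) \<odot> braiding (src f) = (idn V \<star> f) \<odot> braiding (src f)"
    using f by (simp add: seq_assoc[symmetric] del: seq_assoc)
  ultimately show ?thesis using f by (simp add: braiding_def)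
qed

text \<open>The flip of \<open>H W \<otimes> H W'\<close> past \<open>V\<close> splits, and its
  second part cancels the outermost flip in the tensor formula of \<open>\<eta>\<close>.\<close>

lemma swap_eta_tens:
  assumes "W \<in> Obj T" "W' \<in> Obj T"
  shows "swap_eta (W \<otimes> W') = (swap_eta W \<star> idn (H W')) \<odot> (idn W \<star> swap_eta W')"
proof -
  let ?s = "(E W \<star> idn (H W')) \<odot> (idn W \<star> flip (H W') V) \<odot> (idn W \<star> E W')"
  have "(idn (H W) \<star> flip (H W') V) \<odot> (idn (H W) \<star> flip V (H W')) = idn (H W \<otimes> V \<otimes> H W')"
    using assms by (simp add: interchange flip_flip)
  then have "((idn (H W) \<star> flip (H W') V) \<odot> (idn (H W) \<star> flip V (H W'))) \<odot> ?s = ?s"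
    using assms by simp
  then have "swap_eta (W \<otimes> W') = (flip (H W) V \<star> idn (H W')) \<odot> ?s"
    using assms by (simp add: swap_eta_def E_tens flip_par)
  then show ?thesis using assms by (simp add: swap_eta_def seq_par_idn)
qed

text \<open>Here the compatibility of \<open>\<xi>\<close> with \<open>\<eta>\<close> enters.
  \<open>L W\<close> cancels against the braiding, the next flip cancels the one in
  \<open>swap_eta\<close>, and the remaining \<open>E W\<close> commutes with
  \<open>L W'\<close>.\<close>

lemma L_tens_braiding:
  assumes "W \<in> Obj T" "W' \<in> Obj T"
  shows "L (W \<otimes> W') \<odot> (braiding W \<star> idn W') = (swap_eta W \<star> idn (H W')) \<odot> (idn W \<star> L W')"
proof -
  have 1: "(L W \<star> idn W') \<odot> (braiding W \<star> idn W') = swap_eta W \<star> idn W'"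
    using assms by (simp add: seq_par_idn[symmetric] L_braiding)
  have "flip V (H W) \<odot> swap_eta W = (flip V (H W) \<odot> flip (H W) V) \<odot> E W"
    using assms by (simp add: swap_eta_def)
  then have "flip V (H W) \<odot> swap_eta W = E W" using assms by (simp add: flip_flip)
  then have 2: "(flip V (H W) \<star> idn W') \<odot> (swap_eta W \<star> idn W') = E W \<star> idn W'"
    using assms by (simp add: seq_par_idn[symmetric])
  have "L (W \<otimes> W') \<odot> (braiding W \<star> idn W')
      = (flip (H W) V \<star> idn (H W')) \<odot> (idn (H W) \<star> L W') \<odot> (E W \<star> idn W')"
    using assms by (simp add: L_tens 1 2)
  then show ?thesis
    using assms by (simp add: E_L_commute[symmetric] swap_eta_def seq_par_idn)
qed

text \<open>As \<open>L (W \<otimes> W')\<close> is unitary, both sides may be compared after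
  composing with it, where each becomes \<open>swap_eta (W \<otimes> W')\<close>.\<close>

lemma braiding_tens:
  assumes "W \<in> Obj T" "W' \<in> Obj T"
  shows "braiding (W \<otimes> W') = (braiding W \<star> idn W') \<odot> (idn W \<star> braiding W')"
proof -
  let ?s = "(braiding W \<star> idn W') \<odot> (idn W \<star> braiding W')"
  have "L (W \<otimes> W') \<odot> ?s = (L (W \<otimes> W') \<odot> (braiding W \<star> idn W')) \<odot> (idn W \<star> braiding W')"
    using assms by simp
  also have "\<dots> = (swap_eta W \<star> idn (H W')) \<odot> (idn W \<star> (L W' \<odot> braiding W'))"
    using assms by (simp add: L_tens_braiding seq_par_idn)
  also have "\<dots> = swap_eta (W \<otimes> W')"
    using assms by (simp add: L_braiding swap_eta_tens)
  finally have "(adj (L (W \<otimes> W')) \<odot> L (W \<otimes> W')) \<odot> ?s = braiding (W \<otimes> W')"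
    using assms by (simp add: braiding_def del: L_adj)
  then show ?thesis using assms by simp
qed

lemma braiding_standard:
  "standard_braided_symmetry T \<iota> \<theta> \<xi> V \<eta> (\<lambda>W. (\<xi> W)\<^sup>\<dagger> \<cdot> \<theta> (H W) V \<cdot> \<eta> W)"
proof -
  have arr: "(\<xi> W)\<^sup>\<dagger> \<cdot> \<theta> (H W) V \<cdot> \<eta> W = arr (braiding W)" for W by (simp add: braiding_def swap_eta_def)
  have "unitary T (W \<otimes> V) (V \<otimes> W) (arr (braiding W))" if "W \<in> Obj T" for W
    using unitary_iff[of "braiding W"] braiding_unitary that by simp
  moreover have "arr (braiding W') \<cdot> (f \<boxtimes> \<one> V) = (\<one> V \<boxtimes> f) \<cdot> arr (braiding W)"
    if "W \<in> Obj T" "W' \<in> Obj T" "f \<in> Hom T W W'" for W W' f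
    using arg_cong[OF braiding_natural[of "(W, f, W')"], of arr] that by (simp add: typed_def)
  moreover have "arr (braiding (W \<otimes> W')) = (arr (braiding W) \<boxtimes> \<one> W') \<cdot> (\<one> W \<boxtimes> arr (braiding W'))"
    if "W \<in> Obj T" "W' \<in> Obj T" for W W'
    using arg_cong[OF braiding_tens[OF that], of arr] by simp
  moreover have "\<xi> W \<cdot> arr (braiding W) = \<theta> (H W) V \<cdot> \<eta> W" if "W \<in> Obj T" for W
    using arg_cong[OF L_braiding[OF that], of arr] by (simp add: swap_eta_def)
  ultimately show ?thesis
    unfolding standard_braided_symmetry_def braided_symmetry_def unitary_nat_trans_def arr
    using regular by (simp add: left_tensor_def right_tensor_def)
qed

end

theorem corollary2p5:
  fixes T :: "('o, 'a::complex_normed_vector) tcat"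
    and \<iota> :: "('o, 'a, 'o, 'a) functor_maps"
    and \<theta> :: "'o \<Rightarrow> 'o \<Rightarrow> 'a"
    and V :: 'o and \<xi> \<eta> :: "'o \<Rightarrow> 'a"
  assumes "hilbert_functor T \<iota> \<theta>"
    and "regular_object T \<iota> \<theta> \<xi> V \<eta>"
  shows "multiplicative_unitary (functor_image T \<iota>) \<theta> (on_ob \<iota> V) (on_ar \<iota> (\<eta> V))
    \<and> multiplicative_unitary (functor_image T \<iota>) \<theta> (on_ob \<iota> V) ((on_ar \<iota> (\<xi> V))\<^sup>\<dagger>\<^bsub>T\<^esub>)
    \<and> (\<exists>S. tensor_subcategory S
             (rep_category (hilbert_copies T \<iota>) (hilbert_flip \<iota> \<theta>) (on_ob \<iota> V) (on_ar \<iota> (\<eta> V)))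
         \<and> tensor_star_isomorphism T S
             \<lparr>on_ob = (\<lambda>W. (W, on_ar \<iota> (\<eta> W))), on_ar = on_ar \<iota>\<rparr>)
    \<and> (\<exists>S. tensor_subcategory S
             (corep_category (hilbert_copies T \<iota>) (hilbert_flip \<iota> \<theta>) (on_ob \<iota> V) ((on_ar \<iota> (\<xi> V))\<^sup>\<dagger>\<^bsub>T\<^esub>))
         \<and> tensor_star_isomorphism T S
             \<lparr>on_ob = (\<lambda>W. (W, (on_ar \<iota> (\<xi> W))\<^sup>\<dagger>\<^bsub>T\<^esub>)), on_ar = on_ar \<iota>\<rparr>)
    \<and> standard_braided_symmetry T \<iota> \<theta> \<xi> V \<eta>
         (\<lambda>W. (\<xi> W)\<^sup>\<dagger>\<^bsub>T\<^esub> \<cdot>\<^bsub>T\<^esub> \<theta> (on_ob \<iota> W) V \<cdot>\<^bsub>T\<^esub> \<eta> W)"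
proof -
  interpret hilbert_functor T \<iota> \<theta> by (rule assms(1))
  interpret regular_triple T \<iota> \<theta> V \<xi> \<eta>
    using assms(2) by unfold_locales (simp_all add: regular_object_def)
  show ?thesis
    using eta_multiplicative_unitary xi_multiplicative_unitary rep_subcategory corep_subcategory
      braiding_standard by blast
qed

end
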